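(* Fix an integer $k\ge 2$ and let $\tilde{B}_r$ be as in the context. Let $J\ge 0$, $i\in\{2,\dots,k\}$ and $r=(k-1)J+i$. Then $\tilde{B}_r=\sum_{n\ge0}\tilde{b}_{k,r}(n)q^n$, where $\tilde{b}_{k,r}(n)$ is the number of partitions $\pi=(\pi_1,\dots,\pi_{\ell(\pi)})$ of $n$ such that: (1) $\pi_t-\pi_{t+k-1}\ge 2$ for all $t$ with $t+k-1\le\ell(\pi)$; (2) $\pi_{\ell(\pi)}\ge J+1$; (3) $m_{J+1}(\pi)\le k-i$; (4) for all $t$ with $t+k-2\le\ell(\pi)$, $\pi_t-\pi_{t+k-2}\le 1$ only if $\pi_t+\pi_{t+1}+\cdots+\pi_{t+k-2}\equiv r+k+1\pmod 2$.
   Context: $q$ is a formal variable and all series lie in $\mathbb{C}((q))$. Write $(q)_\infty=\prod_{s\ge1}(1-q^s)$. Fix $k\ge 2$. For $i\in\{1,\dots,k\}$ set $B_i=\prod_{m\ge 1}(1-q^{2km})(1-q^{2km-k+i-1})(1-q^{2km-k-i+1})/(q)_\infty$. Recursively, for each $j\ge 0$, given $B_{(k-1)j+1},\dots,B_{(k-1)j+k}$, define ghost series $\tilde{B}_{(k-1)j+i}=(B_{(k-1)j+i-1}+q^{j+1}B_{(k-1)j+i+1})/(1+q^{j+1})$ for $i\in\{2,\dots,k-1\}$ and $\tilde{B}_{(k-1)j+k}=B_{(k-1)j+k-1}/(1+q^{j+1})$; then $B_{(k-1)(j+1)+1}$ is the already defined $B_{(k-1)j+k}$, $B_{(k-1)(j+1)+2}=(B_{(k-1)j+k-1}-\tilde{B}_{(k-1)j+k})/q^{j+1}$,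 and $B_{(k-1)(j+1)+i}=(B_{(k-1)j+k-i+1}-\tilde{B}_{(k-1)j+k-i+2})/q^{(j+1)(i-1)}$ for $i\in\{3,\dots,k\}$. A partition of $n$ is a nonincreasing finite sequence $\pi_1\ge\cdots\ge\pi_{\ell(\pi)}$ of positive integers summing to $n$ (the empty partition counts for $n=0$); $m_p(\pi)$ is the number of parts equal to $p$. *)

theory Defs
  imports
    "HOL-Analysis.Analysis"
    "HOL-Computational_Algebra.Computational_Algebra"
    "HOL-Number_Theory.Cong"
begin

text \<open>
  Infinite products are limits of partial products in the \<open>q\<close>-adic topology of
  formal power series; all further arithmetic takes place in the field \<^typ>\<open>complex fls\<close> of
  formal Laurent series, with \<^term>\<open>fls_X\<close> in the role of \<open>q\<close>. Products over
  \<open>m \<ge> 1\<close> are indexed by \<open>Suc m\<close>, \<open>m \<ge> 0\<close>.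
\<close>

definition q_inf :: "complex fps" where
  "q_inf = (\<Prod>s. 1 - fps_X ^ Suc s)"

text \<open>For \<open>1 \<le> i \<le> k\<close> the natural-number subtractions in the exponents do not truncate.\<close>

definition B_init :: "nat \<Rightarrow> nat \<Rightarrow> complex fls" where
  "B_init k i =
     fps_to_fls (\<Prod>m. (1 - fps_X ^ (2 * k * Suc m))
                     * (1 - fps_X ^ (2 * k * Suc m - k + i - 1))
                     * (1 - fps_X ^ (2 * k * Suc m - k - i + 1)))
     / fps_to_fls q_inf"

text \<open>
  Given \<open>b i\<close>, \<open>1 \<le> i \<le> k\<close>, standing for the series with index \<open>(k - 1) * j + i\<close>, this is the
  ghost series with index \<open>(k - 1) * j + i\<close>, for \<open>2 \<le> i \<le> k\<close>.
\<close>

definition ghost_of :: "nat \<Rightarrow> nat \<Rightarrow> (nat \<Rightarrow> complex fls) \<Rightarrow> nat \<Rightarrow> complex fls" where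
  "ghost_of k j b i =
     (if i = k then b (k - 1) / (1 + fls_X ^ (j + 1))
      else (b (i - 1) + fls_X ^ (j + 1) * b (i + 1)) / (1 + fls_X ^ (j + 1)))"

text \<open>\<open>B_block k j i\<close> is the series with index \<open>(k - 1) * j + i\<close>, for \<open>1 \<le> i \<le> k\<close>.\<close>

primrec B_block :: "nat \<Rightarrow> nat \<Rightarrow> nat \<Rightarrow> complex fls" where
  "B_block k 0 = B_init k"
| "B_block k (Suc j) = (\<lambda>i.
     if i = 1 then B_block k j k
     else if i = 2 then
       (B_block k j (k - 1) - ghost_of k j (B_block k j) k) / fls_X ^ (j + 1)
     else
       (B_block k j (k - i + 1) - ghost_of k j (B_block k j) (k - i + 2))
         / fls_X ^ ((j + 1) * (i - 1)))"

text \<open>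
  The families indexed by a single \<open>r\<close>. An index \<open>r \<ge> 2\<close> is \<open>(k - 1) * j + i\<close> for exactly one
  pair with \<open>2 \<le> i \<le> k\<close>, namely \<open>j = block_of k r\<close> and \<open>i = pos_of k r\<close>. The lemmas below
  are the defining recursion in terms of \<open>r\<close>.
\<close>

definition block_of :: "nat \<Rightarrow> nat \<Rightarrow> nat" where
  "block_of k r = (r - 2) div (k - 1)"

definition pos_of :: "nat \<Rightarrow> nat \<Rightarrow> nat" where
  "pos_of k r = r - (k - 1) * block_of k r"

definition B_series :: "nat \<Rightarrow> nat \<Rightarrow> complex fls" where
  "B_series k r = B_block k (block_of k r) (pos_of k r)"

definition ghost_series :: "nat \<Rightarrow> nat \<Rightarrow> complex fls" where
  "ghost_series k r = ghost_of k (block_of k r) (B_block k (block_of k r)) (pos_of k r)"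

lemma block_of_eq:
  assumes "2 \<le> i" "i \<le> k"
  shows "block_of k ((k - 1) * j + i) = j"
proof -
  have "(k - 1) * j + i - 2 = (i - 2) + (k - 1) * j"
    using assms by simp
  moreover have "i - 2 < k - 1" using assms by linarith
  ultimately show ?thesis
    unfolding block_of_def by simp
qed

lemma pos_of_eq:
  assumes "2 \<le> i" "i \<le> k"
  shows "pos_of k ((k - 1) * j + i) = i"
  unfolding pos_of_def block_of_eq[OF assms] by simp

lemma B_series_eq:
  assumes "2 \<le> k" "1 \<le> i" "i \<le> k"
  shows "B_series k ((k - 1) * j + i) = B_block k j i"
proof (cases "i = 1")
  case False
  with assms have "2 \<le> i" by linarith
  with assms show ?thesis
    unfolding B_series_def by (simp only: block_of_eq pos_of_eq)
next
  case i: True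
  show ?thesis
  proof (cases j)
    case 0
    with i show ?thesis by (simp add: B_series_def block_of_def pos_of_def)
  next
    case (Suc l)
    have "(k - 1) * j + i = (k - 1) * l + k"
      using assms i Suc by simp
    then have "B_series k ((k - 1) * j + i) = B_block k l k"
      using assms unfolding B_series_def by (simp only: block_of_eq pos_of_eq order_refl)
    with i Suc show ?thesis by simp
  qed
qed

lemma ghost_series_eq:
  assumes "2 \<le> i" "i \<le> k"
  shows "ghost_series k ((k - 1) * j + i) = ghost_of k j (B_block k j) i"
  unfolding ghost_series_def block_of_eq[OF assms] pos_of_eq[OF assms] ..

lemma B_series_init:
  assumes "2 \<le> k" "1 \<le> i" "i \<le> k"
  shows "B_series k i = B_init k i"
  using B_series_eq[OF assms, of 0] by simp

lemma ghost_series_mid: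
  assumes "2 \<le> i" "i \<le> k - 1"
  shows "ghost_series k ((k - 1) * j + i) =
    (B_series k ((k - 1) * j + (i - 1)) + fls_X ^ (j + 1) * B_series k ((k - 1) * j + (i + 1)))
      / (1 + fls_X ^ (j + 1))"
proof -
  have "2 \<le> k" "1 \<le> i - 1" "i - 1 \<le> k" "1 \<le> i + 1" "i + 1 \<le> k" "i \<le> k" "i \<noteq> k"
    using assms by linarith+
  then show ?thesis
    using assms(1) by (simp only: B_series_eq ghost_series_eq ghost_of_def if_False)
qed

lemma ghost_series_last:
  assumes "2 \<le> k"
  shows "ghost_series k ((k - 1) * j + k) =
    B_series k ((k - 1) * j + (k - 1)) / (1 + fls_X ^ (j + 1))"
proof -
  have "1 \<le> k - 1" "k - 1 \<le> k" using assms by linarith+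
  then show ?thesis
    using assms by (simp only: B_series_eq ghost_series_eq ghost_of_def order_refl) simp
qed

lemma B_series_step_2:
  assumes "2 \<le> k"
  shows "B_series k ((k - 1) * (j + 1) + 2) =
    (B_series k ((k - 1) * j + (k - 1)) - ghost_series k ((k - 1) * j + k)) / fls_X ^ (j + 1)"
proof -
  have "1 \<le> k - 1" "k - 1 \<le> k" "(1::nat) \<le> 2" using assms by linarith+
  then show ?thesis
    using assms by (simp only: B_series_eq ghost_series_eq order_refl) simp
qed

lemma B_series_step:
  assumes "3 \<le> i" "i \<le> k"
  shows "B_series k ((k - 1) * (j + 1) + i) =
    (B_series k ((k - 1) * j + (k - i + 1)) - ghost_series k ((k - 1) * j + (k - i + 2)))
      / fls_X ^ ((j + 1) * (i - 1))"
proof -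
  have "2 \<le> k" "1 \<le> i" "1 \<le> k - i + 1" "k - i + 1 \<le> k" "2 \<le> k - i + 2" "k - i + 2 \<le> k"
    using assms by linarith+
  then show ?thesis
    using assms by (simp only: B_series_eq ghost_series_eq) simp
qed

definition is_partition :: "nat \<Rightarrow> nat list \<Rightarrow> bool" where
  "is_partition n \<pi> \<longleftrightarrow> sorted_wrt (\<ge>) \<pi> \<and> (\<forall>p \<in> set \<pi>. 0 < p) \<and> sum_list \<pi> = n"

text \<open>
  The number of partitions counted by the coefficient of \<open>q ^ n\<close> for the index
  \<open>r = (k - 1) * J + i\<close>. Lists are indexed from 0, so position \<open>t\<close> here is position \<open>t + 1\<close> in
  the usual notation; the differences of parts do not truncate since the parts are nonincreasing.
\<close>

definition ghost_count :: "nat \<Rightarrow> nat \<Rightarrow> nat \<Rightarrow> nat \<Rightarrow> nat" where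
  "ghost_count k J i n = card {\<pi>. is_partition n \<pi> \<and>
     (\<forall>t. t + k - 1 < length \<pi> \<longrightarrow> \<pi> ! t - \<pi> ! (t + k - 1) \<ge> 2) \<and>
     (\<pi> \<noteq> [] \<longrightarrow> last \<pi> \<ge> J + 1) \<and>
     count_list \<pi> (J + 1) \<le> k - i \<and>
     (\<forall>t. t + k - 2 < length \<pi> \<longrightarrow> \<pi> ! t - \<pi> ! (t + k - 2) \<le> 1 \<longrightarrow>
        [(\<Sum>u = t..t + k - 2. \<pi> ! u) = ((k - 1) * J + i) + k + 1] (mod 2))}"

end

theory Submission
  imports Defs
begin

text \<open>
  Removing the smallest parts \<open>j + 1\<close> from the partitions with the difference and parity conditions
  leaves partitions of the same kind with parts at least \<open>j + 2\<close>; whether the parity condition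
  on the window made of all parts \<open>j + 1\<close> and \<open>j + 2\<close> is automatic or contradictory depends only on
  the residue class. Hence, with \<open>b\<^bsub>j,i\<^esub>\<close> the generating function for one parity, \<open>g\<^bsub>j,i\<^esub>\<close> the one for
  the other parity and \<open>b\<^bsub>j,k+1\<^esub> = 0\<close>,
  \<open>b\<^bsub>j,i-1\<^esub> = g\<^bsub>j,i\<^esub> + q\<^bsup>(j+1)(k-i+1)\<^esup> b\<^bsub>j+1,k-i+2\<^esub>\<close> and
  \<open>g\<^bsub>j,i\<^esub> = b\<^bsub>j,i+1\<^esub> + q\<^bsup>(j+1)(k-i)\<^esup> b\<^bsub>j+1,k-i+2\<^esub>\<close>, which are the recursions defining the
  series and their ghosts.
  It remains to identify the rows \<open>j = 0\<close>. Eliminating \<open>g\<close> gives a recursion in which row \<open>j\<close> is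
  determined by row \<open>j + 1\<close>; together with \<open>b\<^bsub>j,i\<^esub> \<rightarrow> 1\<close> as \<open>j \<rightarrow> \<infinity>\<close> it has at most one solution.
  A second solution is a family of explicit alternating sums, whose row \<open>j = 0\<close> is the given product by
  Jacobi's triple product identity.
\<close>

subsection \<open>Truncation, infinite products and series\<close>

text \<open>Agreement of two series up to order \<open>N\<close> is expressed throughout as
  divisibility of their difference by \<open>fps_X ^ N\<close>, so that approximations can be
  chained by ring laws for \<open>dvd\<close>.\<close>

lemma fps_X_power_dvd_iff: "(fps_X :: complex fps) ^ N dvd f \<longleftrightarrow> (\<forall>n<N. fps_nth f n = 0)"
proof (cases "f = 0")
  case False
  then have "fps_X ^ N dvd f \<longleftrightarrow> N \<le> subdegree f"
    by (simp add: fps_dvd_iff)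
  also have "\<dots> \<longleftrightarrow> (\<forall>n<N. fps_nth f n = 0)"
    using False by (auto intro: subdegree_geI nth_less_subdegree_zero)
  finally show ?thesis .
qed simp

lemma fps_eqI_X_power_dvd:
  assumes "\<And>N. (fps_X :: complex fps) ^ N dvd f - g"
  shows "f = g"
proof (rule fps_ext)
  fix n
  show "fps_nth f n = fps_nth g n"
    using assms[of "Suc n"] unfolding fps_X_power_dvd_iff by simp
qed

lemma dvd_diff_trans:
  fixes d :: "'a :: comm_ring_1"
  assumes "d dvd x - y" "d dvd y - z"
  shows "d dvd x - z"
  using dvd_add[OF assms] by simp

lemma dvd_diff_mult:
  fixes d :: "'a :: comm_ring_1"
  assumes "d dvd x - y" "d dvd z - w"
  shows "d dvd x * z - y * w"
proof -
  have "x * z - y * w = (x - y) * z + y * (z - w)"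
    by (simp add: algebra_simps)
  then show ?thesis using assms by simp
qed

lemma dvd_diff_sym:
  fixes d :: "'a :: comm_ring_1"
  assumes "d dvd x - y"
  shows "d dvd y - x"
  using assms by (metis dvd_minus_iff minus_diff_eq)

lemma dvd_diff_prod:
  fixes d :: "'a :: comm_ring_1"
  assumes "\<And>x. x \<in> A \<Longrightarrow> d dvd f x - g x"
  shows "d dvd prod f A - prod g A"
  using assms by (induction A rule: infinite_finite_induct) (auto intro: dvd_diff_mult)

lemma prod_cong_X_power:
  assumes f: "\<And>m. (fps_X :: complex fps) ^ Suc m dvd f m - 1" and "N \<le> M"
  shows "fps_X ^ N dvd (\<Prod>m<M. f m) - (\<Prod>m<N. f m)"
  using \<open>N \<le> M\<close>
proof (induction M rule: dec_induct)
  case (step M)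
  have "fps_X ^ N dvd f M - 1"
    using f[of M] step.hyps by (meson dvd_trans le_imp_power_dvd le_SucI)
  then have "fps_X ^ N dvd (\<Prod>m<M. f m) * (f M) - (\<Prod>m<M. f m) * 1"
    by (intro dvd_diff_mult) auto
  with step.IH show ?case
    by (auto intro: dvd_diff_trans)
qed simp

lemma fps_prodinf_cong:
  assumes f: "\<And>m. (fps_X :: complex fps) ^ Suc m dvd f m - 1"
  shows "fps_X ^ N dvd (\<Prod>m. f m) - (\<Prod>m<N. f m)"
proof -
  define P where "P = Abs_fps (\<lambda>n. fps_nth (\<Prod>m<Suc n. f m) n)"
  have nth: "fps_nth (\<Prod>m<M. f m) n = fps_nth P n" if "n < M" for n M
  proof -
    have "fps_X ^ Suc n dvd (\<Prod>m<M. f m) - (\<Prod>m<Suc n. f m)"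
      using that by (intro prod_cong_X_power f) simp
    then show ?thesis
      unfolding fps_X_power_dvd_iff P_def by simp
  qed
  \<comment> \<open>\<open>has_prod\<close> asks for a nonzero limit of the partial products; the
    constant coefficient 1 of \<open>f 0\<close> ensures this.\<close>
  have "fps_nth (f 0) 0 = 1"
    using f[of 0] unfolding fps_X_power_dvd_iff by simp
  then have "fps_nth P 0 \<noteq> 0"
    by (simp add: P_def)
  then have "P \<noteq> 0" by auto
  moreover have "(\<lambda>n. \<Prod>m\<le>n. f m) \<longlonglongrightarrow> P"
  proof (rule tendsto_fpsI)
    fix n
    show "eventually (\<lambda>M. fps_nth (\<Prod>m\<le>M. f m) n = fps_nth P n) sequentially"
      using eventually_ge_at_top[of n]
      by eventually_elim (auto simp flip: lessThan_Suc_atMost simp del: prod.lessThan_Suc intro!: nth)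
  qed
  ultimately have "f has_prod P"
    by (simp add: has_prod_def raw_has_prod_def)
  then have "(\<Prod>m. f m) = P"
    by (rule has_prod_unique[symmetric])
  then show ?thesis
    using nth unfolding fps_X_power_dvd_iff by simp
qed

text \<open>
  Meaningful only if \<open>fps_X ^ m\<close> divides \<open>f m\<close> for all \<open>m\<close>, so that later terms do not reach the
  \<open>n\<close>-th coefficient.
\<close>

definition fps_sum :: "(nat \<Rightarrow> complex fps) \<Rightarrow> complex fps" where
  "fps_sum f = Abs_fps (\<lambda>n. fps_nth (\<Sum>m\<le>n. f m) n)"

lemma fps_sum_cong_X_power:
  assumes f: "\<And>m. fps_X ^ m dvd f m"
  shows "fps_X ^ N dvd fps_sum f - (\<Sum>m<N. f m)"
  unfolding fps_X_power_dvd_iff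
proof safe
  fix n assume "n < N"
  have "(\<Sum>m<N. fps_nth (f m) n) = (\<Sum>m\<le>n. fps_nth (f m) n)"
  proof (rule sum.mono_neutral_right)
    show "\<forall>m\<in>{..<N} - {..n}. fps_nth (f m) n = 0"
      using f unfolding fps_X_power_dvd_iff by auto
  qed (use \<open>n < N\<close> in auto)
  then show "fps_nth (fps_sum f - (\<Sum>m<N. f m)) n = 0"
    by (simp add: fps_sum_def fps_sum_nth)
qed

lemma fps_sum_eqI:
  assumes "\<And>m. fps_X ^ m dvd f m"
    and "\<And>N. fps_X ^ N dvd P - (\<Sum>m<N. f m)"
  shows "fps_sum f = P"
proof (rule fps_eqI_X_power_dvd)
  fix N
  show "fps_X ^ N dvd fps_sum f - P"
    by (rule dvd_diff_trans[OF fps_sum_cong_X_power[OF assms(1)] dvd_diff_sym[OF assms(2)]])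
qed

lemma fps_sum_add: "fps_sum f + fps_sum g = fps_sum (\<lambda>m. f m + g m)"
  by (rule fps_ext) (simp add: fps_sum_def sum.distrib)

lemma fps_sum_diff: "fps_sum f - fps_sum g = fps_sum (\<lambda>m. f m - g m)"
  by (rule fps_ext) (simp add: fps_sum_def sum_subtractf)

lemma fps_sum_mult:
  assumes "\<And>m. fps_X ^ m dvd f m"
  shows "c * fps_sum f = fps_sum (\<lambda>m. c * f m)"
proof (rule sym, rule fps_sum_eqI)
  show "fps_X ^ m dvd c * f m" for m
    using assms by simp
  show "fps_X ^ N dvd c * fps_sum f - (\<Sum>m<N. c * f m)" for N
    using fps_sum_cong_X_power[OF assms, of N]
    by (simp flip: sum_distrib_left right_diff_distrib)
qed

text \<open>This shift is what allows half of one term to be paired with half of the next when two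
  theta-like series are compared.\<close>

lemma fps_sum_shift:
  assumes f: "\<And>m. fps_X ^ m dvd f m" and "f 0 = 0"
  shows "fps_sum (\<lambda>m. f (Suc m)) = fps_sum f"
proof (rule fps_sum_eqI)
  show *: "fps_X ^ m dvd f (Suc m)" for m
    using f[of "Suc m"] by (rule dvd_trans[rotated]) (simp add: le_imp_power_dvd)
  show "fps_X ^ N dvd fps_sum f - (\<Sum>m<N. f (Suc m))" for N
  proof -
    have "(\<Sum>m<Suc N. f m) = (\<Sum>m<N. f (Suc m))"
      by (simp add: sum.lessThan_Suc_shift \<open>f 0 = 0\<close> del: sum.lessThan_Suc)
    then have "fps_X ^ Suc N dvd fps_sum f - (\<Sum>m<N. f (Suc m))"
      using fps_sum_cong_X_power[OF f, of "Suc N"] by simp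
    then show ?thesis
      by (rule dvd_trans[rotated]) (simp add: le_imp_power_dvd)
  qed
qed

subsection \<open>Jacobi's triple product\<close>

text \<open>Gaussian binomial coefficients, given by a q-Pascal rule so that no division is
  involved. Where the exponent \<open>n - r\<close> truncates, its factor
  \<open>q_binomial Q n r\<close> is zero.\<close>

fun q_binomial :: "'a :: comm_ring_1 \<Rightarrow> nat \<Rightarrow> nat \<Rightarrow> 'a" where
  "q_binomial Q n 0 = 1"
| "q_binomial Q 0 (Suc r) = 0"
| "q_binomial Q (Suc n) (Suc r) = q_binomial Q n (Suc r) + Q ^ (n - r) * q_binomial Q n r"

lemma q_binomial_eq_0: "n < r \<Longrightarrow> q_binomial Q n r = 0"
  by (induction Q n r rule: q_binomial.induct) auto

lemma Suc_choose_2: "Suc n choose 2 = (n choose 2) + n"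
  by (simp add: numeral_2_eq_2)

text \<open>Induction on \<open>M\<close>: multiplying by the last factor and comparing powers of
  \<open>x\<close> gives the Pascal rule. The homogeneous form in \<open>x\<close> and
  \<open>y\<close> allows \<open>y\<close> to be a power of \<open>Q\<close> later, which avoids
  negative exponents.\<close>

lemma q_binomial_theorem:
  fixes x y Q :: "'a :: comm_ring_1"
  shows "(\<Prod>m<M. y + x * Q ^ m) = (\<Sum>r\<le>M. q_binomial Q M r * Q ^ (r choose 2) * x ^ r * y ^ (M - r))"
proof (induction M)
  case (Suc M)
  let ?t = "\<lambda>r. q_binomial Q M r * Q ^ (r choose 2) * x ^ r * y ^ (M - r)"
  have 1: "(\<Sum>r\<le>M. ?t r * y) = (\<Sum>r\<le>Suc M. q_binomial Q M r * Q ^ (r choose 2) * x ^ r * y ^ (Suc M - r))"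
    by (simp add: q_binomial_eq_0 Suc_diff_le mult_ac)
  also have "\<dots> = y ^ Suc M + (\<Sum>r\<le>M. q_binomial Q M (Suc r) * Q ^ (Suc r choose 2) * x ^ Suc r * y ^ (M - r))"
    by (subst sum.atMost_Suc_shift) (simp add: numeral_2_eq_2)
  finally have y: "(\<Sum>r\<le>M. ?t r) * y = \<dots>"
    by (simp only: sum_distrib_right)
  have x: "(\<Sum>r\<le>M. ?t r) * (x * Q ^ M) =
      (\<Sum>r\<le>M. Q ^ (M - r) * q_binomial Q M r * Q ^ (Suc r choose 2) * x ^ Suc r * y ^ (M - r))"
    unfolding sum_distrib_right
  proof (rule sum.cong)
    fix r assume "r \<in> {..M}"
    then have Q: "Q ^ (r choose 2) * Q ^ M = Q ^ (M - r) * Q ^ (Suc r choose 2)"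
      by (simp add: Suc_choose_2 add.commute flip: power_add)
    have "?t r * (x * Q ^ M) = (Q ^ (r choose 2) * Q ^ M) * (q_binomial Q M r * x ^ Suc r * y ^ (M - r))"
      by (simp only: power_Suc mult_ac)
    then show "?t r * (x * Q ^ M) =
        Q ^ (M - r) * q_binomial Q M r * Q ^ (Suc r choose 2) * x ^ Suc r * y ^ (M - r)"
      unfolding Q by (simp only: mult_ac)
  qed simp
  have "(\<Prod>m<Suc M. y + x * Q ^ m) = (\<Sum>r\<le>M. ?t r) * y + (\<Sum>r\<le>M. ?t r) * (x * Q ^ M)"
    by (simp add: Suc.IH distrib_left)
  also have "\<dots> = y ^ Suc M + (\<Sum>r\<le>M. q_binomial Q (Suc M) (Suc r) * Q ^ (Suc r choose 2) * x ^ Suc r * y ^ (M - r))"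
    unfolding x y by (simp add: distrib_right sum.distrib)
  also have "\<dots> = (\<Sum>r\<le>Suc M. q_binomial Q (Suc M) r * Q ^ (r choose 2) * x ^ r * y ^ (Suc M - r))"
    unfolding sum.atMost_Suc_shift[of _ M] by (simp add: numeral_2_eq_2)
  finally show ?case .
qed (simp add: numeral_2_eq_2)

lemma q_binomial_mult_prod:
  "q_binomial Q n r * (\<Prod>s<r. 1 - Q ^ Suc s) = (\<Prod>s<r. 1 - Q ^ (n - s))"
proof (induction Q n r rule: q_binomial.induct)
  case (3 Q n r)
  have "q_binomial Q (Suc n) (Suc r) * (\<Prod>s<Suc r. 1 - Q ^ Suc s) =
      q_binomial Q n (Suc r) * (\<Prod>s<Suc r. 1 - Q ^ Suc s) +
      Q ^ (n - r) * (1 - Q ^ Suc r) * (q_binomial Q n r * (\<Prod>s<r. 1 - Q ^ Suc s))"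
    by (simp add: algebra_simps)
  also have "\<dots> = (\<Prod>s<r. 1 - Q ^ (n - s)) * (1 - Q ^ (n - r) + Q ^ (n - r) * (1 - Q ^ Suc r))"
    unfolding 3 by (simp add: algebra_simps)
  also have "\<dots> = (\<Prod>s<r. 1 - Q ^ (n - s)) * (1 - Q ^ Suc n)"
  proof (cases "r \<le> n")
    case True
    then have "Q ^ (n - r) * Q ^ Suc r = Q ^ Suc n"
      by (simp flip: power_add del: power_Suc)
    then show ?thesis
      by (simp add: algebra_simps)
  next
    \<comment> \<open>For \<open>r > n\<close> the index \<open>s = n\<close> contributes the factor
      \<open>1 - Q ^ 0 = 0\<close>.\<close>
    case False
    then have "(\<Prod>s<r. 1 - Q ^ (n - s)) = 0"
      by (intro prod_zero) (auto intro!: bexI[of _ n])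
    then show ?thesis by simp
  qed
  also have "\<dots> = (\<Prod>s<Suc r. 1 - Q ^ (Suc n - s))"
    by (simp add: prod.lessThan_Suc_shift mult.commute del: prod.lessThan_Suc)
  finally show ?case .
qed auto

lemma add_choose_2: "(m + n) choose 2 = (m choose 2) + (n choose 2) + m * n"
  by (induction n) (simp_all add: Suc_choose_2 numeral_2_eq_2)

lemma prod_power_choose_2: "(\<Prod>m<N. Q ^ m) = (Q :: 'a :: comm_monoid_mult) ^ (N choose 2)"
  by (induction N) (simp_all add: Suc_choose_2 power_add mult.commute binomial_eq_0)

text \<open>The q-binomial theorem is applied to \<open>2 * N\<close> factors with base
  \<open>R = q ^ (a + c)\<close>, \<open>x = - (q ^ a)\<close> and \<open>y = R ^ N\<close>. The
  upper half of the factors gives the product with \<open>a\<close>, the reversed lower half the one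
  with \<open>c\<close>, up to a common monomial.\<close>

lemma finite_triple_product:
  fixes q :: "'a :: idom"
  assumes "q \<noteq> 0"
  defines "Q a c \<equiv> q ^ (a + c)"
  shows "(\<Prod>m<N. (1 - q ^ a * Q a c ^ m) * (1 - q ^ c * Q a c ^ m)) =
    (\<Sum>n\<le>N. (-1) ^ n * q ^ ((a + c) * (n choose 2) + a * n) * q_binomial (Q a c) (2 * N) (N + n)) +
    (\<Sum>n<N. (-1) ^ Suc n * q ^ ((a + c) * (Suc n choose 2) + c * Suc n) *
       q_binomial (Q a c) (2 * N) (N - Suc n))"
proof -
  define R where "R = q ^ (a + c)"
  \<comment> \<open>The monomial extracted from the \<open>2 * N\<close> factors:
    \<open>R ^ (N * N)\<close> from the upper half,
    \<open>(- (q ^ a)) ^ N * R ^ (N choose 2)\<close> from the lower half.\<close>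
  define C where "C = (-1) ^ N * q ^ ((a + c) * ((N choose 2) + N * N) + a * N)"
  have "C \<noteq> 0" using assms by (simp add: C_def)
  have [simp]: "Q a c = R" by (simp add: Q_def R_def)
  have negpow: "(- (q ^ a)) ^ r = (-1) ^ r * q ^ (a * r)" for r
    by (simp add: power_minus[of "q ^ a"] power_mult)
  have Rpow: "R ^ x = q ^ ((a + c) * x)" for x
    by (simp add: R_def power_mult)
  have RN: "(R ^ N) ^ m = q ^ ((a + c) * (N * m))" for m
    by (simp only: R_def power_mult mult.assoc)
  define F where "F r = q_binomial R (2 * N) r * R ^ (r choose 2) * (- (q ^ a)) ^ r * (R ^ N) ^ (2 * N - r)" for r
  have F: "F r = q_binomial R (2 * N) r * (-1) ^ r * q ^ ((a + c) * ((r choose 2) + N * (2 * N - r)) + a * r)" for r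
    unfolding F_def negpow RN unfolding Rpow add_mult_distrib2[of "a + c"] power_add by (simp only: mult_ac)
  have "(\<Prod>m<2 * N. R ^ N + (- (q ^ a)) * R ^ m) =
      (\<Prod>m<N. R ^ N - q ^ a * R ^ m) * (\<Prod>m<N. R ^ N - q ^ a * R ^ (N + m))"
  proof -
    have *: "{..<2 * N} = {..<N} \<union> {N..<N + N}" by auto
    have "(\<Prod>m<2 * N. R ^ N + (- (q ^ a)) * R ^ m) =
      (\<Prod>m<N. R ^ N - q ^ a * R ^ m) * (\<Prod>m=N..<N + N. R ^ N - q ^ a * R ^ m)"
      unfolding * by (subst prod.union_disjoint) auto
    moreover have "(\<Prod>m=N..<N + N. R ^ N - q ^ a * R ^ m) = (\<Prod>m<N. R ^ N - q ^ a * R ^ (N + m))"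
      using prod.shift_bounds_nat_ivl[of "\<lambda>m. R ^ N - q ^ a * R ^ m" 0 N N]
      by (simp add: lessThan_atLeast0 add.commute)
    ultimately show ?thesis by simp
  qed
  also have "(\<Prod>m<N. R ^ N - q ^ a * R ^ (N + m)) = R ^ (N * N) * (\<Prod>m<N. 1 - q ^ a * R ^ m)"
  proof -
    have "R ^ N - q ^ a * R ^ (N + m) = R ^ N * (1 - q ^ a * R ^ m)" for m
      by (simp add: power_add algebra_simps)
    then show ?thesis by (simp add: prod.distrib power_mult)
  qed
  also have "(\<Prod>m<N. R ^ N - q ^ a * R ^ m) = (\<Prod>m<N. R ^ N - q ^ a * R ^ (N - Suc m))"
    by (rule prod.nat_diff_reindex[symmetric])
  also have "\<dots> = (\<Prod>m<N. (- (q ^ a)) * R ^ (N - Suc m) * (1 - q ^ c * R ^ m))"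
  proof (rule prod.cong)
    fix m assume "m \<in> {..<N}"
    then have "R ^ N = R ^ (N - Suc m) * (R * R ^ m)"
      by (simp flip: power_add power_Suc)
    then show "R ^ N - q ^ a * R ^ (N - Suc m) = (- (q ^ a)) * R ^ (N - Suc m) * (1 - q ^ c * R ^ m)"
      by (simp add: R_def power_add algebra_simps)
  qed simp
  also have "\<dots> = (- (q ^ a)) ^ N * R ^ (N choose 2) * (\<Prod>m<N. 1 - q ^ c * R ^ m)"
    using prod.nat_diff_reindex[of "\<lambda>m. R ^ m" N]
    unfolding prod.distrib prod_constant prod_power_choose_2 by simp
  finally have "(\<Prod>m<2 * N. R ^ N + (- (q ^ a)) * R ^ m) =
      C * (\<Prod>m<N. (1 - q ^ a * R ^ m) * (1 - q ^ c * R ^ m))"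
    by (simp add: C_def negpow Rpow prod.distrib power_add add_mult_distrib2 mult_ac)
  then have "C * (\<Prod>m<N. (1 - q ^ a * R ^ m) * (1 - q ^ c * R ^ m)) = (\<Sum>r\<le>2 * N. F r)"
    by (simp only: q_binomial_theorem F_def)
  \<comment> \<open>Centring the index at \<open>N\<close> turns \<open>r = N + n\<close> into the
    nonnegative and \<open>r = N - Suc n\<close> into the negative indices of the bilateral
    sum.\<close>
  also have "\<dots> = (\<Sum>r\<in>{N..N + N}. F r) + (\<Sum>r<N. F r)"
    by (subst sum.union_disjoint[symmetric]) (auto intro: sum.cong)
  also have "(\<Sum>r\<in>{N..N + N}. F r) = (\<Sum>n\<le>N. F (N + n))"
    using sum.shift_bounds_cl_nat_ivl[of F 0 N N] by (simp add: atLeast0AtMost add.commute)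
  also have "(\<Sum>r<N. F r) = (\<Sum>n<N. F (N - Suc n))"
    by (rule sum.nat_diff_reindex[symmetric])
  also have "(\<Sum>n\<le>N. F (N + n)) = C * (\<Sum>n\<le>N. (-1) ^ n * q ^ ((a + c) * (n choose 2) + a * n) * q_binomial R (2 * N) (N + n))"
    unfolding sum_distrib_left
  proof (rule sum.cong)
    fix n assume "n \<in> {..N}"
    then have "N * n + N * (2 * N - (N + n)) = N * N"
      by (simp flip: add_mult_distrib2)
    then have "((N + n) choose 2) + N * (2 * N - (N + n)) = (N choose 2) + N * N + (n choose 2)"
      unfolding add_choose_2 by linarith
    then have "(a + c) * (((N + n) choose 2) + N * (2 * N - (N + n))) + a * (N + n) =
        ((a + c) * ((N choose 2) + N * N) + a * N) + ((a + c) * (n choose 2) + a * n)"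
      by (simp only: distrib_left add_ac)
    then show "F (N + n) = C * ((-1) ^ n * q ^ ((a + c) * (n choose 2) + a * n) * q_binomial R (2 * N) (N + n))"
      unfolding F C_def by (simp only: power_add mult_ac)
  qed simp
  also have "(\<Sum>n<N. F (N - Suc n)) = C * (\<Sum>n<N. (-1) ^ Suc n * q ^ ((a + c) * (Suc n choose 2) + c * Suc n) *
       q_binomial R (2 * N) (N - Suc n))"
    unfolding sum_distrib_left
  proof (rule sum.cong)
    fix n assume "n \<in> {..<N}"
    then obtain d where N: "N = d + Suc n"
      by (metis add.commute lessThan_iff less_imp_Suc_add add_Suc_right)
    have e: "Suc n * Suc n = Suc n + 2 * (Suc n choose 2)"
      by (induction n) (simp_all add: Suc_choose_2 numeral_2_eq_2)
    have "2 * N - d = N + Suc n" using N by simp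
    then have "(a + c) * ((d choose 2) + N * (2 * N - d)) + a * d =
        (a + c) * ((d choose 2) + N * N + d * Suc n + Suc n * Suc n) + a * d"
      by (simp add: N algebra_simps)
    also have "\<dots> = ((a + c) * ((N choose 2) + N * N) + a * N) + ((a + c) * (Suc n choose 2) + c * Suc n)"
      unfolding e unfolding N add_choose_2 by (simp add: algebra_simps)
    finally have "F d = q_binomial R (2 * N) d * (-1) ^ d *
        (q ^ ((a + c) * ((N choose 2) + N * N) + a * N) * q ^ ((a + c) * (Suc n choose 2) + c * Suc n))"
      unfolding F by (simp only: power_add)
    moreover have "(-1) ^ d = (-1 :: 'a) ^ N * (-1) ^ Suc n"
      by (simp add: N power_add mult.assoc flip: power_mult_distrib)
    ultimately have "F d = C * ((-1) ^ Suc n * q ^ ((a + c) * (Suc n choose 2) + c * Suc n) * q_binomial R (2 * N) d)"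
      unfolding C_def by (simp only: mult_ac)
    then show "F (N - Suc n) = C * ((-1) ^ Suc n * q ^ ((a + c) * (Suc n choose 2) + c * Suc n) *
       q_binomial R (2 * N) (N - Suc n))"
      by (simp add: N)
  qed simp
  finally show ?thesis
    using \<open>C \<noteq> 0\<close> by (simp flip: distrib_left)
qed

text \<open>Multiplied by its own denominator, the coefficient becomes a product of factors
  \<open>1 - Q ^ (n - m)\<close> with \<open>n - m > n - r \<ge> s\<close>, hence 1 to order
  \<open>s\<close>. Both \<open>r\<close> and \<open>N\<close> are at least \<open>s\<close>, so
  replacing the denominator by the product of length \<open>N\<close> does not matter to this
  order.\<close>

lemma q_binomial_cong_X_power:
  assumes "0 < e" "s \<le> r" "s \<le> N" "r + s \<le> n"
  defines "Q \<equiv> (fps_X :: complex fps) ^ e"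
  shows "fps_X ^ s dvd q_binomial Q n r * (\<Prod>m<N. 1 - Q ^ Suc m) - 1"
proof -
  have Q: "fps_X ^ m dvd Q ^ m" for m
    using \<open>0 < e\<close> unfolding Q_def power_mult[symmetric] by (intro le_imp_power_dvd) simp
  have *: "fps_X ^ Suc m dvd (1 - Q ^ Suc m) - 1" for m
    using Q[of "Suc m"] by simp
  have "fps_X ^ s dvd (\<Prod>m<N. 1 - Q ^ Suc m) - (\<Prod>m<r. 1 - Q ^ Suc m)"
    by (rule dvd_diff_trans[OF prod_cong_X_power[OF *] dvd_diff_sym[OF prod_cong_X_power[OF *]]])
      (use assms in auto)
  then have "fps_X ^ s dvd q_binomial Q n r * (\<Prod>m<N. 1 - Q ^ Suc m) -
      q_binomial Q n r * (\<Prod>m<r. 1 - Q ^ Suc m)"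
    by (intro dvd_diff_mult) auto
  moreover have "fps_X ^ s dvd (\<Prod>m<r. 1 - Q ^ (n - m)) - (\<Prod>m<r. 1)"
  proof (rule dvd_diff_prod)
    fix m assume "m \<in> {..<r}"
    then have "(fps_X :: complex fps) ^ s dvd fps_X ^ (n - m)"
      using assms by (intro le_imp_power_dvd) simp
    then have "fps_X ^ s dvd Q ^ (n - m)"
      by (rule dvd_trans[OF _ Q])
    then show "fps_X ^ s dvd 1 - Q ^ (n - m) - 1"
      by simp
  qed
  ultimately have "fps_X ^ s dvd q_binomial Q n r * (\<Prod>m<N. 1 - Q ^ Suc m) - (\<Prod>m<r. 1)"
    unfolding q_binomial_mult_prod by (rule dvd_diff_trans)
  then show ?thesis by simp
qed

lemma X_power_dvd_signed_power: "n \<le> e \<Longrightarrow> (fps_X :: complex fps) ^ n dvd (-1) ^ m * fps_X ^ e"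
  by (intro dvd_mult le_imp_power_dvd)

theorem jacobi_triple_product:
  assumes "0 < a" "0 < c"
  shows "(\<Prod>m. (1 - fps_X ^ ((a + c) * Suc m)) * (1 - fps_X ^ ((a + c) * m + a))
             * (1 - fps_X ^ ((a + c) * m + c))) =
    fps_sum (\<lambda>n. (-1) ^ n * fps_X ^ ((a + c) * (n choose 2) + a * n) * (1 - fps_X ^ (c * (2 * n + 1))))"
    (is "prodinf ?p = fps_sum ?t")
proof (rule sym, rule fps_sum_eqI)
  fix N
  define Q where "Q = (fps_X :: complex fps) ^ (a + c)"
  define R where "R = (\<Prod>m<N. 1 - Q ^ Suc m)"
  define pos where "pos n = (-1) ^ n * (fps_X :: complex fps) ^ ((a + c) * (n choose 2) + a * n)" for n
  define neg where "neg n = (-1) ^ n * (fps_X :: complex fps) ^ ((a + c) * (n choose 2) + c * n)" for n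
  have pos: "fps_X ^ n dvd pos n" and neg: "fps_X ^ n dvd neg n" for n
    unfolding pos_def neg_def using assms by (auto intro!: X_power_dvd_signed_power trans_le_add2)
  \<comment> \<open>The series on the right folds the bilateral sum by pairing the index
    \<open>n\<close> with \<open>-n - 1\<close>.\<close>
  have t: "?t n = pos n + neg (Suc n)" for n
  proof -
    have "(a + c) * (Suc n choose 2) + c * Suc n = (a + c) * (n choose 2) + a * n + c * (2 * n + 1)"
      by (simp add: Suc_choose_2 algebra_simps)
    then have "neg (Suc n) = - (pos n * fps_X ^ (c * (2 * n + 1)))"
      unfolding neg_def pos_def by (simp only: power_add power_Suc mult_ac mult_minus1 mult_minus_left mult_minus_right mult_1_left)
    then show ?thesis
      by (simp only: pos_def right_diff_distrib mult_1_right) simp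
  qed
  have "fps_X ^ Suc m dvd ?p m - 1" for m
  proof -
    have "fps_X ^ Suc m dvd (1 - fps_X ^ e) - (1 :: complex fps)" if "Suc m \<le> e" for e
      using that by (simp add: le_imp_power_dvd del: power_Suc)
    moreover have "m \<le> (a + c) * m" using assms by simp
    then have "m + 1 \<le> (a + c) * m + a" "m + 1 \<le> (a + c) * m + c"
      using assms by (auto intro!: add_mono simp del: add_Suc_right One_nat_def)
    moreover have "1 * Suc m \<le> (a + c) * Suc m"
      using assms by (intro mult_le_mono1) simp
    ultimately have "fps_X ^ Suc m dvd ?p m - 1 * 1 * 1"
      by (intro dvd_diff_mult) simp_all
    then show ?thesis by simp
  qed
  then have "fps_X ^ N dvd prodinf ?p - (\<Prod>m<N. ?p m)"
    by (rule fps_prodinf_cong)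
  also have "(\<Prod>m<N. ?p m) =
      (\<Sum>n\<le>N. pos n * (q_binomial Q (2 * N) (N + n) * R)) +
      (\<Sum>n<N. neg (Suc n) * (q_binomial Q (2 * N) (N - Suc n) * R))"
  proof -
    have "(\<Prod>m<N. ?p m) = R * (\<Prod>m<N. (1 - fps_X ^ a * Q ^ m) * (1 - fps_X ^ c * Q ^ m))"
    proof -
      have 1: "fps_X ^ ((a + c) * m) = Q ^ m" for m
        by (simp only: Q_def power_mult)
      have 2: "fps_X ^ ((a + c) * m + e) = fps_X ^ e * Q ^ m" for m e
        unfolding power_add 1 by (rule mult.commute)
      show ?thesis
        unfolding R_def prod.distrib[symmetric] 1 2 by (simp only: mult.assoc)
    qed
    also have "(\<Prod>m<N. (1 - fps_X ^ a * Q ^ m) * (1 - fps_X ^ c * Q ^ m)) =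
       (\<Sum>n\<le>N. pos n * q_binomial Q (2 * N) (N + n)) +
       (\<Sum>n<N. neg (Suc n) * q_binomial Q (2 * N) (N - Suc n))"
      unfolding Q_def pos_def neg_def by (rule finite_triple_product) simp
    finally show ?thesis
      by (simp add: distrib_left sum_distrib_left mult_ac)
  qed
  finally have "fps_X ^ N dvd prodinf ?p - ((\<Sum>n\<le>N. pos n * (q_binomial Q (2 * N) (N + n) * R)) +
      (\<Sum>n<N. neg (Suc n) * (q_binomial Q (2 * N) (N - Suc n) * R)))" .
  moreover have "fps_X ^ N dvd
      ((\<Sum>n\<le>N. pos n * (q_binomial Q (2 * N) (N + n) * R)) +
      (\<Sum>n<N. neg (Suc n) * (q_binomial Q (2 * N) (N - Suc n) * R))) - ((\<Sum>n\<le>N. pos n) + (\<Sum>n<N. neg (Suc n)))"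
  proof -
    \<comment> \<open>Far from the centre the binomial factor is known only to order
      \<open>N - n\<close>, but the term itself is divisible by \<open>fps_X ^ n\<close>, which
      makes up for the loss.\<close>
    have aux: "fps_X ^ N dvd t * (b * R) - t"
      if "fps_X ^ n dvd t" "n \<le> N" "fps_X ^ (N - n) dvd b * R - 1" for t b n
    proof -
      have "fps_X ^ n * fps_X ^ (N - n) dvd t * (b * R - 1)"
        using that by (intro mult_dvd_mono)
      then show ?thesis
        using that(2) by (simp add: right_diff_distrib flip: power_add)
    qed
    have "fps_X ^ N dvd pos n * (q_binomial Q (2 * N) (N + n) * R) - pos n" if "n \<le> N" for n
      by (rule aux[OF pos \<open>n \<le> N\<close>], unfold R_def Q_def, rule q_binomial_cong_X_power)
        (use assms that in auto)
    moreover have "fps_X ^ N dvd neg (Suc n) * (q_binomial Q (2 * N) (N - Suc n) * R) - neg (Suc n)"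
      if "n < N" for n
      by (rule aux[OF neg], use that in simp, unfold R_def Q_def, rule q_binomial_cong_X_power)
        (use assms that in auto)
    ultimately show ?thesis
      unfolding add_diff_add sum_subtractf[symmetric] by (intro dvd_add dvd_sum) auto
  qed
  ultimately have "fps_X ^ N dvd prodinf ?p - ((\<Sum>n\<le>N. pos n) + (\<Sum>n<N. neg (Suc n)))"
    by (rule dvd_diff_trans)
  \<comment> \<open>The only discrepancy between the two sums is \<open>pos N\<close>, which has
    order at least \<open>N\<close>.\<close>
  moreover have "fps_X ^ N dvd ((\<Sum>n\<le>N. pos n) + (\<Sum>n<N. neg (Suc n))) - (\<Sum>n<N. ?t n)"
    using pos[of N] by (simp only: t sum.distrib lessThan_Suc_atMost[symmetric] sum.lessThan_Suc) simp
  ultimately show "fps_X ^ N dvd prodinf ?p - (\<Sum>n<N. ?t n)"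
    by (rule dvd_diff_trans)
next
  fix n
  show "fps_X ^ n dvd ?t n"
    using assms by (intro dvd_mult2 X_power_dvd_signed_power trans_le_add2) simp
qed

subsection \<open>Closed form of the shelves\<close>

text \<open>The q-Pochhammer symbol (q^(2n+2); q^2)_j. Its two recursions, extending it at the upper
  or at the lower end, drive the comparison of rows \<open>j\<close> and
  \<open>j + 1\<close>.\<close>

definition even_prod :: "nat \<Rightarrow> nat \<Rightarrow> complex fps" where
  "even_prod j n = (\<Prod>s<j. 1 - fps_X ^ (2 * (n + Suc s)))"

lemma even_prod_Suc: "even_prod (Suc j) n = even_prod j n * (1 - fps_X ^ (2 * (n + Suc j)))"
  by (simp add: even_prod_def)

lemma even_prod_Suc_shift: "even_prod (Suc j) n = (1 - fps_X ^ (2 * Suc n)) * even_prod j (Suc n)"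
  by (simp add: even_prod_def prod.lessThan_Suc_shift del: prod.lessThan_Suc)

text \<open>
  Here and below \<open>K = k - 1\<close> and \<open>u = i - 1\<close>. At \<open>j = 0\<close> the terms are those of the theta series
  \<open>\<Sum>n\<in>\<int>. (-1) ^ n * q ^ ((K + 1) * n\<^sup>2 + u * n)\<close> with \<open>n\<close> and \<open>-n - 1\<close> paired; for \<open>u = K + 1\<close> they vanish.
\<close>

definition shelf_term :: "nat \<Rightarrow> nat \<Rightarrow> nat \<Rightarrow> nat \<Rightarrow> complex fps" where
  "shelf_term K j u n = (-1) ^ n * fps_X ^ ((K + 1) * n\<^sup>2 + (j * K + u) * n) * even_prod j n
     * (1 - fps_X ^ ((2 * n + j + 1) * (K + 1 - u)))"

definition shelf_num :: "nat \<Rightarrow> nat \<Rightarrow> nat \<Rightarrow> complex fps" where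
  "shelf_num K j u = fps_sum (shelf_term K j u)"

lemma X_power_dvd_shelf_term: "fps_X ^ n dvd shelf_term K j u n"
proof -
  have "n \<le> (K + 1) * n\<^sup>2"
    by (simp add: power2_eq_square trans_le_add1)
  then show ?thesis
    unfolding shelf_term_def
    by (intro dvd_mult2 X_power_dvd_signed_power trans_le_add1)
qed

text \<open>For \<open>u = 0\<close> the two halves of each term are separated into
  \<open>a n\<close> and \<open>b (Suc n)\<close> and re-paired at equal index. With x = q^n and y =
  q^(j+1) the claim becomes (1 - x^2 y^2) + y (1 - x^2) = (1 + y)(1 - x^2 y).\<close>

lemma shelf_num_Suc_0: "shelf_num K (Suc j) 0 = (1 + fps_X ^ Suc j) * shelf_num K j K"
proof -
  define a where "a n = (-1) ^ n * (fps_X :: complex fps) ^ ((K + 1) * n\<^sup>2 + (Suc j * K) * n) * even_prod (Suc j) n" for n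
  define b where "b n = (-1) ^ n * (fps_X :: complex fps) ^ ((K + 1) * n\<^sup>2 + (Suc j * K) * n + Suc j)
      * ((1 - fps_X ^ (2 * n)) * even_prod j n)" for n
  have le: "n \<le> (K + 1) * n\<^sup>2" for n
    by (simp add: power2_eq_square trans_le_add1)
  have b: "fps_X ^ n dvd b n" for n
    unfolding b_def by (intro dvd_mult2 X_power_dvd_signed_power trans_le_add1 le)
  have "shelf_term K (Suc j) 0 n = a n + b (Suc n)" for n
  proof -
    have "(K + 1) * (Suc n)\<^sup>2 + (Suc j * K) * Suc n + Suc j =
        ((K + 1) * n\<^sup>2 + (Suc j * K) * n) + (2 * n + Suc j + 1) * (K + 1)"
      by (simp add: power2_eq_square algebra_simps)
    then have "b (Suc n) = - (a n * fps_X ^ ((2 * n + Suc j + 1) * (K + 1)))"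
      unfolding b_def a_def even_prod_Suc_shift[symmetric]
      by (simp only: power_add power_Suc mult_ac mult_minus1 mult_minus_left mult_minus_right mult_1_left)
    then show ?thesis
      by (simp add: shelf_term_def a_def right_diff_distrib)
  qed
  then have "shelf_num K (Suc j) 0 = fps_sum a + fps_sum (\<lambda>n. b (Suc n))"
    unfolding shelf_num_def fps_sum_add by (intro arg_cong[of _ _ fps_sum] ext)
  also have "fps_sum (\<lambda>n. b (Suc n)) = fps_sum b"
    by (rule fps_sum_shift[OF b]) (simp add: b_def)
  also have "fps_sum a + fps_sum b = fps_sum (\<lambda>n. (1 + fps_X ^ Suc j) * shelf_term K j K n)"
    unfolding fps_sum_add
  proof (intro arg_cong[of _ _ fps_sum] ext)
    fix n
    define x :: "complex fps" where "x = fps_X ^ n"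
    define y :: "complex fps" where "y = fps_X ^ Suc j"
    have "(2 * n + j + 1) * (K + 1 - K) = n + n + Suc j" by simp
    then have x: "fps_X ^ (2 * n) = x * x" "fps_X ^ (2 * (n + Suc j)) = x * x * (y * y)"
      "fps_X ^ ((2 * n + j + 1) * (K + 1 - K)) = x * x * y"
      by (simp_all only: x_def y_def power_add mult_2 mult_2_right mult_ac)
    have e: "(K + 1) * n\<^sup>2 + (j * K + K) * n = (K + 1) * n\<^sup>2 + Suc j * K * n"
      by simp
    show "a n + b n = (1 + fps_X ^ Suc j) * shelf_term K j K n"
      unfolding a_def b_def shelf_term_def e even_prod_Suc x power_add[of _ _ "Suc j"]
      unfolding y_def[symmetric] by (simp only: algebra_simps mult_1_left)
  qed
  also have "\<dots> = (1 + fps_X ^ Suc j) * shelf_num K j K"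
    unfolding shelf_num_def by (rule fps_sum_mult[symmetric, OF X_power_dvd_shelf_term])
  finally show ?thesis .
qed

text \<open>The difference of terms is split into \<open>a n\<close>, which vanishes at
  \<open>n = 0\<close> and is moved by one index, and \<open>b n\<close>; then
  \<open>a (Suc n)\<close> and \<open>b n\<close> are the two halves of a term of row
  \<open>j + 1\<close>. Writing the width as \<open>w + d + 1\<close> avoids truncated
  subtraction.\<close>

lemma shelf_num_step:
  "shelf_num (w + d + 1) j w - shelf_num (w + d + 1) j (w + 2) =
    fps_X ^ (Suc j * d) * shelf_num (w + d + 1) (Suc j) (d + 1)"
proof -
  define K where "K = w + d + 1"
  define a where "a n = (-1) ^ n * (fps_X :: complex fps) ^ ((K + 1) * n\<^sup>2 + (j * K + w) * n) * ((1 - fps_X ^ (2 * n)) * even_prod j n)" for n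
  define b where "b n = (-1) ^ n * (fps_X :: complex fps) ^ ((K + 1) * n\<^sup>2 + (Suc j * K + (d + 1)) * n + Suc j * d)
      * even_prod (Suc j) n" for n
  have le: "n \<le> (K + 1) * n\<^sup>2" for n
    by (simp add: power2_eq_square trans_le_add1)
  have a: "fps_X ^ n dvd a n" for n
    unfolding a_def by (intro dvd_mult2 X_power_dvd_signed_power trans_le_add1 le)
  have "shelf_term K j w n - shelf_term K j (w + 2) n = a n + b n" for n
  proof -
    define E where "E = (K + 1) * n\<^sup>2 + (j * K + w) * n"
    define m where "m = 2 * n + j + 1"
    have e: "(K + 1) * n\<^sup>2 + (j * K + (w + 2)) * n = E + 2 * n"
      "(K + 1) * n\<^sup>2 + (Suc j * K + (d + 1)) * n + Suc j * d = E + 2 * n + m * d"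
      by (simp_all add: E_def m_def K_def algebra_simps)
    have K: "K + 1 - w = d + 2" "K + 1 - (w + 2) = d" by (simp_all add: K_def)
    have m: "m * (d + 2) = 2 * n + m * d + 2 * (n + Suc j)"
      by (simp add: m_def algebra_simps)
    \<comment> \<open>In these letters the splitting reads (1 - xyz) - x (1 - y) = (1 - x) + xy (1 -
      z).\<close>
    define x y z :: "complex fps" where "x = fps_X ^ (2 * n)" and "y = fps_X ^ (m * d)"
      and "z = fps_X ^ (2 * (n + Suc j))"
    show ?thesis
      unfolding shelf_term_def a_def b_def e K unfolding even_prod_Suc E_def[symmetric] m_def[symmetric] m power_add
      unfolding x_def[symmetric] y_def[symmetric] z_def[symmetric]
      by (simp only: algebra_simps mult_1_left)
  qed
  then have "shelf_num K j w - shelf_num K j (w + 2) = fps_sum a + fps_sum b"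
    unfolding shelf_num_def fps_sum_diff fps_sum_add by (intro arg_cong[of _ _ fps_sum] ext)
  also have "fps_sum a = fps_sum (\<lambda>n. a (Suc n))"
    by (rule fps_sum_shift[OF a, symmetric]) (simp add: a_def)
  also have "fps_sum (\<lambda>n. a (Suc n)) + fps_sum b =
      fps_sum (\<lambda>n. fps_X ^ (Suc j * d) * shelf_term K (Suc j) (d + 1) n)"
    unfolding fps_sum_add
  proof (intro arg_cong[of _ _ fps_sum] ext)
    fix n
    define E where "E = (K + 1) * n\<^sup>2 + (Suc j * K + (d + 1)) * n"
    have e: "(K + 1) * (Suc n)\<^sup>2 + (j * K + w) * Suc n = E + Suc j * d + (2 * n + Suc j + 1) * (w + 1)"
      by (simp add: E_def K_def power2_eq_square algebra_simps)
    have K: "K + 1 - (d + 1) = w + 1" by (simp add: K_def)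
    define x y z :: "complex fps" where "x = fps_X ^ E" and "y = fps_X ^ (Suc j * d)"
      and "z = fps_X ^ ((2 * n + Suc j + 1) * (w + 1))"
    show "a (Suc n) + b n = fps_X ^ (Suc j * d) * shelf_term K (Suc j) (d + 1) n"
      unfolding shelf_term_def a_def b_def e K even_prod_Suc_shift[symmetric]
      unfolding E_def[symmetric] power_add[of _ _ "(2 * n + Suc j + 1) * (w + 1)"]
        power_add[of _ _ "Suc j * d"] power_Suc[of "-1 :: complex fps"]
      unfolding x_def[symmetric] y_def[symmetric] z_def[symmetric]
      by (simp add: algebra_simps)
  qed
  also have "\<dots> = fps_X ^ (Suc j * d) * shelf_num K (Suc j) (d + 1)"
    unfolding shelf_num_def by (rule fps_sum_mult[symmetric, OF X_power_dvd_shelf_term])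
  finally show ?thesis by (simp only: K_def)
qed

section \<open>Normalised shelves, their limit and their uniqueness\<close>

definition shelf_den :: "nat \<Rightarrow> complex fps" where
  "shelf_den j = q_inf * (\<Prod>s<j. 1 + fps_X ^ Suc s)"

text \<open>Dividing by (q)_inf (-q; q)_j absorbs the factor \<open>1 + fps_X ^ Suc j\<close> of
  \<open>shelf_num_Suc_0\<close> and makes the rows tend to 1.\<close>

definition shelf :: "nat \<Rightarrow> nat \<Rightarrow> nat \<Rightarrow> complex fps" where
  "shelf K j u = shelf_num K j u * inverse (shelf_den j)"

lemma q_inf_cong: "fps_X ^ N dvd q_inf - (\<Prod>s<N. 1 - fps_X ^ Suc s)"
  unfolding q_inf_def by (rule fps_prodinf_cong) simp

lemma q_inf_nth_0: "fps_nth q_inf 0 = 1"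
  using q_inf_cong[of 1] unfolding fps_X_power_dvd_iff by simp

lemma shelf_den_nth_0: "fps_nth (shelf_den j) 0 = 1"
  by (induction j) (simp_all add: shelf_den_def q_inf_nth_0)

lemma shelf_den_Suc: "inverse (shelf_den j) = (1 + fps_X ^ Suc j) * inverse (shelf_den (Suc j))"
proof -
  have "shelf_den (Suc j) = shelf_den j * (1 + fps_X ^ Suc j)"
    by (simp add: shelf_den_def mult.assoc)
  then have "shelf_den j * ((1 + fps_X ^ Suc j) * inverse (shelf_den (Suc j))) = 1"
    using inverse_mult_eq_1'[of "shelf_den (Suc j)"] by (simp add: shelf_den_nth_0 mult.assoc)
  then show ?thesis
    by (rule fps_inverse_unique)
qed

lemma shelf_edge: "shelf K (Suc j) 0 = shelf K j K"
  unfolding shelf_def shelf_num_Suc_0 shelf_den_Suc[of j] by (simp only: mult_ac)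

lemma shelf_step:
  assumes "w < K"
  shows "shelf K j w = shelf K j (w + 2) +
    fps_X ^ (Suc j * (K - Suc w)) * (1 + fps_X ^ Suc j) * shelf K (Suc j) (K - w)"
proof -
  obtain d where K: "K = w + d + 1"
    using assms less_imp_Suc_add[of w K] by auto
  have "K - w = d + 1" "K - Suc w = d" by (simp_all add: K)
  moreover have "shelf K j w - shelf K j (w + 2) =
    fps_X ^ (Suc j * d) * (1 + fps_X ^ Suc j) * shelf K (Suc j) (d + 1)"
    unfolding shelf_def K left_diff_distrib[symmetric] shelf_num_step shelf_den_Suc[of j]
    by (simp only: mult_ac)
  ultimately show ?thesis by (simp add: algebra_simps)
qed

lemma shelf_top: "shelf K j (K + 1) = 0"
proof -
  have "shelf_num K j (K + 1) = 0"
    by (rule fps_ext) (simp add: shelf_num_def fps_sum_def fps_sum_nth shelf_term_def)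
  then show ?thesis
    by (simp add: shelf_def)
qed

text \<open>All terms of positive index have order at least \<open>j\<close>, and the term of index
  0 is (q^2; q^2)_j = (q; q)_j (-q; q)_j to that order. This agrees with \<open>shelf_den j\<close>,
  since (q; q)_j is (q)_inf to order \<open>j\<close>.\<close>

lemma shelf_cong_1:
  assumes "0 < K" "u \<le> K"
  shows "fps_X ^ j dvd shelf K j u - 1"
proof -
  have "fps_X ^ j dvd shelf_num K j u - (\<Sum>m<Suc j. shelf_term K j u m)"
    unfolding shelf_num_def
    by (rule dvd_trans[OF _ fps_sum_cong_X_power[OF X_power_dvd_shelf_term]]) (simp add: le_imp_power_dvd)
  moreover have "fps_X ^ j dvd (\<Sum>m<Suc j. shelf_term K j u m) - shelf_term K j u 0"
  proof -
    have "fps_X ^ j dvd shelf_term K j u (Suc m)" for m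
    proof -
      have "j * 1 \<le> j * (K * Suc m)"
        using \<open>0 < K\<close> by (intro mult_le_mono2) simp
      then have "j \<le> j * K * Suc m" by (simp only: mult.assoc mult_1_right)
      also have "\<dots> \<le> (K + 1) * (Suc m)\<^sup>2 + (j * K + u) * Suc m"
        unfolding add_mult_distrib by (simp only: add.commute trans_le_add1 le_refl)
      finally show ?thesis
        unfolding shelf_term_def by (intro dvd_mult2 X_power_dvd_signed_power)
    qed
    then show ?thesis
      by (simp add: sum.lessThan_Suc_shift dvd_sum del: sum.lessThan_Suc)
  qed
  moreover have "fps_X ^ j dvd shelf_term K j u 0 - shelf_den j"
  proof -
    have "j \<le> (j + 1) * (K + 1 - u)"
      using \<open>u \<le> K\<close> by (cases "K + 1 - u") auto
    then have "fps_X ^ j dvd shelf_term K j u 0 - even_prod j 0"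
      unfolding shelf_term_def by (simp add: right_diff_distrib le_imp_power_dvd)
    moreover have "even_prod j 0 = (\<Prod>s<j. 1 - fps_X ^ Suc s) * (\<Prod>s<j. 1 + fps_X ^ Suc s)"
    proof -
      have "1 - (fps_X :: complex fps) ^ (2 * Suc s) = (1 - fps_X ^ Suc s) * (1 + fps_X ^ Suc s)" for s
        by (simp only: mult_2 power_add) (simp add: algebra_simps)
      then show ?thesis
        unfolding even_prod_def prod.distrib[symmetric] by (simp only: add_0)
    qed
    moreover have "fps_X ^ j dvd (\<Prod>s<j. 1 - fps_X ^ Suc s) * (\<Prod>s<j. 1 + fps_X ^ Suc s) - shelf_den j"
      unfolding shelf_den_def by (rule dvd_diff_mult[OF dvd_diff_sym[OF q_inf_cong]]) simp
    ultimately show ?thesis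
      using dvd_diff_trans by simp
  qed
  ultimately have "fps_X ^ j dvd shelf_num K j u - shelf_den j"
    using dvd_diff_trans by blast
  then have "fps_X ^ j dvd shelf_num K j u * inverse (shelf_den j) - shelf_den j * inverse (shelf_den j)"
    by (rule dvd_diff_mult) simp
  then show ?thesis
    by (simp add: shelf_def inverse_mult_eq_1' shelf_den_nth_0)
qed

text \<open>
  The recursion expresses row \<open>j\<close> linearly through row \<open>j + 1\<close>, and all rows far down agree to high order.
\<close>

lemma shelf_unique:
  assumes edge: "\<And>j. b (Suc j) 0 = b j K"
    and top: "\<And>j. b j (K + 1) = 0"
    and step: "\<And>j w. w < K \<Longrightarrow> b j w = b j (w + 2) +
      fps_X ^ (Suc j * (K - Suc w)) * (1 + fps_X ^ Suc j) * b (Suc j) (K - w)"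
    and lim: "\<And>j u. u \<le> K \<Longrightarrow> fps_X ^ j dvd b j u - 1"
    and "0 < K" "u \<le> K"
  shows "b j u = shelf K j u"
proof (rule fps_eqI_X_power_dvd)
  fix N
  show "fps_X ^ N dvd b j u - shelf K j u"
    using \<open>u \<le> K\<close>
  \<comment> \<open>Backward induction on the row: from row \<open>N\<close> on, both families are 1
    to order \<open>N\<close>.\<close>
  proof (induction "N - j" arbitrary: j u)
    case 0
    then have "(fps_X :: complex fps) ^ N dvd fps_X ^ j"
      by (intro le_imp_power_dvd) simp
    moreover have "fps_X ^ j dvd b j u - shelf K j u"
      using lim[OF 0(2)] dvd_diff_sym[OF shelf_cong_1[OF \<open>0 < K\<close> 0(2)]] by (rule dvd_diff_trans)
    ultimately show ?case by (rule dvd_trans)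
  next
    case (Suc x)
    then have IH: "fps_X ^ N dvd b (Suc j) v - shelf K (Suc j) v" if "v \<le> K" for v
      using that by (intro Suc.hyps(1)) auto
    \<comment> \<open>Within a row the induction descends from \<open>K + 1\<close>; this position
      is included because the step at \<open>u = K - 1\<close> refers to it.\<close>
    have "u \<le> K + 1" using Suc.prems by simp
    then show ?case
    proof (induction "K + 1 - u" arbitrary: u rule: less_induct)
      case less
      consider "u = K + 1" | "u = K" | "u < K" using less.prems by linarith
      then show ?case
      proof cases
        case 3
        then have "fps_X ^ N dvd b j (u + 2) - shelf K j (u + 2)"
          by (intro less.hyps) auto
        moreover have "fps_X ^ N dvd c * b (Suc j) (K - u) - c * shelf K (Suc j) (K - u)" for c
          using IH[of "K - u"] by (simp flip: right_diff_distrib)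
        ultimately show ?thesis
          unfolding step[OF 3] shelf_step[OF 3] add_diff_add by (rule dvd_add)
      qed (use IH[of 0] in \<open>simp_all add: top[simplified] shelf_top[simplified] edge shelf_edge\<close>)
    qed
  qed
qed

lemma B_init_eq_shelf:
  assumes "u \<le> K"
  shows "B_init (K + 1) (u + 1) = fps_to_fls (shelf K 0 u)"
proof -
  \<comment> \<open>With \<open>k = K + 1\<close> and \<open>i = u + 1\<close> these are
    \<open>k + i - 1\<close> and \<open>k - i + 1\<close>, the residues modulo \<open>2 * k\<close>
    of the exponents in the product.\<close>
  define a where "a = K + 1 + u"
  define c where "c = K + 1 - u"
  have "0 < a" "0 < c" "a + c = 2 * (K + 1)" using assms by (auto simp: a_def c_def)
  have "2 * (K + 1) * Suc m - (K + 1) + (u + 1) - 1 = (a + c) * m + a"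
    "2 * (K + 1) * Suc m - (K + 1) - (u + 1) + 1 = (a + c) * m + c" for m
    using assms unfolding \<open>a + c = _\<close> by (auto simp: a_def c_def)
  then have "(\<Prod>m. (1 - fps_X ^ (2 * (K + 1) * Suc m))
      * (1 - fps_X ^ (2 * (K + 1) * Suc m - (K + 1) + (u + 1) - 1))
      * (1 - fps_X ^ (2 * (K + 1) * Suc m - (K + 1) - (u + 1) + 1))) =
    (\<Prod>m. (1 - (fps_X :: complex fps) ^ ((a + c) * Suc m)) * (1 - fps_X ^ ((a + c) * m + a))
             * (1 - fps_X ^ ((a + c) * m + c)))"
    unfolding \<open>a + c = _\<close> by (simp only:)
  also have "\<dots> = fps_sum (\<lambda>n. (-1) ^ n * fps_X ^ ((a + c) * (n choose 2) + a * n) * (1 - fps_X ^ (c * (2 * n + 1))))"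
    by (rule jacobi_triple_product) fact+
  also have "\<dots> = shelf_num K 0 u"
    unfolding shelf_num_def
  proof (intro arg_cong[of _ _ fps_sum] ext)
    fix n
    have "n\<^sup>2 = 2 * (n choose 2) + n"
      by (induction n) (simp_all add: Suc_choose_2 power2_eq_square numeral_2_eq_2)
    then have "(a + c) * (n choose 2) + a * n = (K + 1) * n\<^sup>2 + (0 * K + u) * n"
      unfolding \<open>a + c = _\<close> unfolding a_def by (simp add: algebra_simps)
    then show "(-1) ^ n * fps_X ^ ((a + c) * (n choose 2) + a * n) * (1 - fps_X ^ (c * (2 * n + 1))) =
        shelf_term K 0 u n"
      by (simp add: shelf_term_def even_prod_def c_def mult.commute)
  qed
  finally have "B_init (K + 1) (u + 1) = fps_to_fls (shelf_num K 0 u) / fps_to_fls q_inf"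
    unfolding B_init_def by simp
  also have "\<dots> = fps_to_fls (shelf K 0 u)"
    by (simp add: shelf_def shelf_den_def divide_inverse fls_times_fps_to_fls q_inf_nth_0 fls_inverse_fps_to_fls subdegree_eq_0)
  finally show ?thesis .
qed

subsection \<open>Partitions with difference and parity conditions\<close>

text \<open>The difference and parity conditions of the theorem for \<open>K = k - 1\<close>. The
  residue \<open>p\<close> is left free because shelves and ghosts need opposite parities.\<close>

definition admissible :: "nat \<Rightarrow> nat \<Rightarrow> nat list \<Rightarrow> bool" where
  "admissible K p \<pi> \<longleftrightarrow> sorted_wrt (\<ge>) \<pi> \<and>
     (\<forall>t. t + K < length \<pi> \<longrightarrow> \<pi> ! t - \<pi> ! (t + K) \<ge> 2) \<and>
     (\<forall>t. t + K - 1 < length \<pi> \<longrightarrow> \<pi> ! t - \<pi> ! (t + K - 1) \<le> 1 \<longrightarrow>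
        [(\<Sum>u = t..t + K - 1. \<pi> ! u) = p] (mod 2))"

lemma admissible_diff:
  "admissible K p \<pi> \<Longrightarrow> t + K < length \<pi> \<Longrightarrow> 2 \<le> \<pi> ! t - \<pi> ! (t + K)"
  by (simp add: admissible_def)

lemma admissible_parity:
  "admissible K p \<pi> \<Longrightarrow> t + K - 1 < length \<pi> \<Longrightarrow> \<pi> ! t - \<pi> ! (t + K - 1) \<le> 1 \<Longrightarrow>
    [(\<Sum>u = t..t + K - 1. \<pi> ! u) = p] (mod 2)"
  by (simp only: admissible_def)

definition adm_lists :: "nat \<Rightarrow> nat \<Rightarrow> nat \<Rightarrow> nat \<Rightarrow> nat list set" where
  "adm_lists K j m p = {\<pi>. admissible K p \<pi> \<and> (\<forall>x\<in>set \<pi>. j + 1 \<le> x) \<and> count_list \<pi> (j + 1) \<le> m}"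

lemma count_list_replicate: "count_list (replicate n x) y = (if x = y then n else 0)"
  by (induction n) auto

lemma sorted_desc_split:
  assumes "sorted_wrt (\<ge>) \<pi>" "\<forall>x\<in>set \<pi>. (a :: nat) \<le> x"
  obtains \<mu> where "\<pi> = \<mu> @ replicate (count_list \<pi> a) a" "sorted_wrt (\<ge>) \<mu>" "\<forall>x\<in>set \<mu>. a + 1 \<le> x"
proof -
  have "\<pi> = filter (\<lambda>x. x \<noteq> a) \<pi> @ replicate (count_list \<pi> a) a"
    using assms
  proof (induction \<pi>)
    case (Cons x \<pi>)
    then have IH: "\<pi> = filter (\<lambda>x. x \<noteq> a) \<pi> @ replicate (count_list \<pi> a) a"
      by simp
    show ?case
    proof (cases "x = a")
      case True
      with Cons.prems have "\<forall>y\<in>set \<pi>. y = a" by (auto intro: antisym)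
      then have "filter (\<lambda>x. x \<noteq> a) \<pi> = []" by (simp add: filter_empty_conv)
      then show ?thesis using True IH by simp
    next
      case False
      then show ?thesis using IH by simp
    qed
  qed simp
  moreover have "sorted_wrt (\<ge>) (filter (\<lambda>x. x \<noteq> a) \<pi>)"
    using assms by (intro sorted_wrt_filter)
  moreover have "\<forall>x\<in>set (filter (\<lambda>x. x \<noteq> a) \<pi>). a + 1 \<le> x"
    using assms(2) by (auto simp: le_less Suc_le_eq)
  ultimately show ?thesis by (rule that)
qed

lemma sum_nth_two_blocks:
  fixes a b :: nat
  assumes "\<pi> = \<mu> @ replicate c b @ replicate m a" "t = length \<mu>" "0 < c + m"
  shows "(\<Sum>u = t..t + (c + m) - 1. \<pi> ! u) = c * b + m * a"
proof -
  have "{t..t + (c + m) - 1} = {0 + t..<(c + m) + t}"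
    using assms(3) by auto
  then have "(\<Sum>u = t..t + (c + m) - 1. \<pi> ! u) = (\<Sum>u = 0..<c + m. \<pi> ! (u + t))"
    by (simp only: sum.shift_bounds_nat_ivl)
  also have "\<dots> = (\<Sum>u = 0..<c + m. (replicate c b @ replicate m a) ! u)"
    by (simp add: assms(1,2) nth_append)
  also have "\<dots> = sum_list (replicate c b @ replicate m a)"
    by (subst sum_list_sum_nth) simp
  finally show ?thesis by (simp add: sum_list_replicate)
qed

text \<open>A window that starts at a part at least \<open>a + 2\<close> and ends at
  \<open>a\<close> satisfies both conditions trivially. So the new constraints concern only the
  parts \<open>a + 1\<close> and \<open>a\<close>: more than \<open>K\<close> of them violate the
  difference condition, and exactly \<open>K\<close> form one window of spread at most 1, whose sum
  must have the right parity.\<close>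

lemma admissible_append_replicate:
  assumes K: "0 < K" and sorted: "sorted_wrt (\<ge>) \<nu>" and ge: "\<forall>x\<in>set \<nu>. a + 1 \<le> x"
  defines "c \<equiv> count_list \<nu> (a + 1)"
  shows "admissible K p (\<nu> @ replicate m a) \<longleftrightarrow>
    admissible K p \<nu> \<and> c + m \<le> K \<and> (c + m = K \<longrightarrow> [c * (a + 1) + m * a = p] (mod 2))"
    (is "_ \<longleftrightarrow> ?rhs")
proof -
  obtain \<mu> where "\<nu> = \<mu> @ replicate (count_list \<nu> (a + 1)) (a + 1)" and "\<forall>x\<in>set \<mu>. a + 1 + 1 \<le> x"
    by (rule sorted_desc_split[OF sorted ge])
  then have \<nu>: "\<nu> = \<mu> @ replicate c (a + 1)" and \<mu>: "\<forall>x\<in>set \<mu>. a + 2 \<le> x"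
    by (simp_all only: c_def add.assoc one_add_one)
  define \<pi> where "\<pi> = \<nu> @ replicate m a"
  define l where "l = length \<mu>"
  have \<pi>: "\<pi> = \<mu> @ replicate c (a + 1) @ replicate m a"
    by (simp add: \<pi>_def \<nu>)
  have len: "length \<nu> = l + c" "length \<pi> = l + c + m"
    by (simp_all add: \<nu> \<pi> l_def)
  have nth_\<nu>: "\<pi> ! t = \<nu> ! t" if "t < l + c" for t
    using that len by (simp add: \<pi>_def nth_append)
  have nth_hi: "a + 2 \<le> \<pi> ! t" if "t < l" for t
    using that \<mu> by (simp add: \<pi> nth_append l_def)
  have nth_mid: "\<pi> ! t = a + 1" if "l \<le> t" "t < l + c" for t
    using that by (simp add: \<pi> nth_append l_def)
  have nth_lo: "\<pi> ! t = a" if "l + c \<le> t" "t < l + c + m" for t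
    using that by (simp add: \<pi> nth_append l_def)
  have nth_le: "\<pi> ! t \<le> a + 1" if "l \<le> t" "t < l + c + m" for t
    using nth_mid nth_lo that by (cases "t < l + c") auto
  have "sorted_wrt (\<ge>) (replicate m a)"
    by (induction m) auto
  moreover have "x \<ge> a" if "x \<in> set \<nu>" for x
    using ge that by fastforce
  ultimately have sorted_\<pi>: "sorted_wrt (\<ge>) \<pi>"
    using sorted unfolding \<pi>_def sorted_wrt_append by auto
  have sum: "(\<Sum>u = l..l + K - 1. \<pi> ! u) = c * (a + 1) + m * a" if "c + m = K"
    using sum_nth_two_blocks[OF \<pi> l_def] that K by simp
  have sum_\<nu>: "(\<Sum>u = t..t + K - 1. \<pi> ! u) = (\<Sum>u = t..t + K - 1. \<nu> ! u)" if "t + K - 1 < l + c" for t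
    using that by (intro sum.cong refl nth_\<nu>) auto
  show ?thesis
    unfolding \<pi>_def[symmetric]
  proof
    assume adm: "admissible K p \<pi>"
    have "admissible K p \<nu>"
      unfolding admissible_def len
    proof (intro conjI allI impI)
      fix t assume t: "t + K < l + c"
      then show "2 \<le> \<nu> ! t - \<nu> ! (t + K)"
        using admissible_diff[OF adm, of t] nth_\<nu>[of t] nth_\<nu>[of "t + K"] by (simp add: len)
    next
      fix t assume t: "t + K - 1 < l + c" and d: "\<nu> ! t - \<nu> ! (t + K - 1) \<le> 1"
      then have "\<pi> ! t - \<pi> ! (t + K - 1) \<le> 1"
        using nth_\<nu>[of t] nth_\<nu>[of "t + K - 1"] K by simp
      then show "[\<Sum>u = t..t + K - 1. \<nu> ! u = p] (mod 2)"
        using admissible_parity[OF adm, of t] t unfolding sum_\<nu>[OF t, symmetric] by (simp add: len)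
    qed (fact sorted)
    moreover have le: "c + m \<le> K"
    proof (rule ccontr)
      assume "\<not> c + m \<le> K"
      then have "l + K < length \<pi>" by (simp add: len)
      then have "2 \<le> \<pi> ! l - \<pi> ! (l + K)"
        by (rule admissible_diff[OF adm])
      moreover have "\<pi> ! l \<le> a + 1"
        using \<open>\<not> c + m \<le> K\<close> by (intro nth_le) auto
      moreover have "a \<le> \<pi> ! (l + K)"
        using nth_mid[of "l + K"] nth_lo[of "l + K"] \<open>\<not> c + m \<le> K\<close> by (cases "l + K < l + c") auto
      ultimately show False by simp
    qed
    moreover have "[c * (a + 1) + m * a = p] (mod 2)" if "c + m = K"
    proof -
      have t: "l + K - 1 < length \<pi>" using that K by (simp add: len)
      have "\<pi> ! l \<le> a + 1"
        using that K by (intro nth_le) auto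
      moreover have "a \<le> \<pi> ! (l + K - 1)"
        using nth_mid[of "l + K - 1"] nth_lo[of "l + K - 1"] that K
        by (cases "l + K - 1 < l + c") auto
      ultimately have "\<pi> ! l - \<pi> ! (l + K - 1) \<le> 1" by simp
      then show ?thesis
        unfolding sum[OF that, symmetric] by (rule admissible_parity[OF adm t])
    qed
    ultimately show ?rhs by blast
  next
    assume rhs: ?rhs
    show "admissible K p \<pi>"
      unfolding admissible_def
    proof (intro conjI allI impI)
      fix t assume t: "t + K < length \<pi>"
      show "2 \<le> \<pi> ! t - \<pi> ! (t + K)"
      proof (cases "t + K < l + c")
        case True
        then show ?thesis
          using rhs admissible_diff[of K p \<nu> t] nth_\<nu>[of t] nth_\<nu>[of "t + K"] by (simp add: len)
      next
        case False
        then have "\<pi> ! (t + K) = a" using t by (intro nth_lo) (auto simp: len)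
        moreover have "a + 2 \<le> \<pi> ! t"
          using t rhs by (intro nth_hi) (auto simp: len)
        ultimately show ?thesis by simp
      qed
    next
      fix t assume t: "t + K - 1 < length \<pi>" and d: "\<pi> ! t - \<pi> ! (t + K - 1) \<le> 1"
      show "[\<Sum>u = t..t + K - 1. \<pi> ! u = p] (mod 2)"
      proof (cases "t + K - 1 < l + c")
        case True
        then have "\<nu> ! t - \<nu> ! (t + K - 1) \<le> 1"
          using d nth_\<nu>[of t] nth_\<nu>[of "t + K - 1"] K by simp
        then show ?thesis
          using rhs admissible_parity[of K p \<nu> t] True unfolding sum_\<nu>[OF True] by (simp add: len)
      next
        case False
        then have "\<pi> ! (t + K - 1) = a" using t by (intro nth_lo) (auto simp: len)
        then have "\<pi> ! t \<le> a + 1" using d by simp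
        then have "l \<le> t" using nth_hi[of t] by (cases "t < l") auto
        \<comment> \<open>A window of \<open>K\<close> parts inside a final block of at most
          \<open>K\<close> parts is the whole block.\<close>
        then have "t = l" "c + m = K" using t rhs K by (auto simp: len)
        then show ?thesis using rhs sum by simp
      qed
    qed (fact sorted_\<pi>)
  qed
qed

section \<open>Generating functions and removal of the smallest parts\<close>

definition gen_fun :: "nat list set \<Rightarrow> complex fps" where
  "gen_fun A = Abs_fps (\<lambda>n. of_nat (card {\<pi> \<in> A. sum_list \<pi> = n}))"

lemma length_le_sum_list: "(\<forall>x\<in>set \<pi>. 0 < x) \<Longrightarrow> length \<pi> \<le> sum_list (\<pi> :: nat list)"
  by (induction \<pi>) (auto simp: Suc_le_eq)

text \<open>Zero entries could be repeated without changing the sum; positivity excludes this, so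
  that \<open>card\<close> is not the default value 0 of an infinite set when generating functions
  are added.\<close>

lemma finite_sum_list_eq:
  assumes "\<And>\<pi>. \<pi> \<in> A \<Longrightarrow> \<forall>x\<in>set \<pi>. (0 :: nat) < x"
  shows "finite {\<pi> \<in> A. sum_list \<pi> = n}"
proof (rule finite_subset)
  show "{\<pi> \<in> A. sum_list \<pi> = n} \<subseteq> {\<pi>. set \<pi> \<subseteq> {..n} \<and> length \<pi> \<le> n}"
    using assms length_le_sum_list by (auto intro: member_le_sum_list)
  show "finite {\<pi>. set \<pi> \<subseteq> {..n} \<and> length \<pi> \<le> n}"
    by (rule finite_lists_length_le) simp
qed

lemma gen_fun_Un:
  assumes "\<And>\<pi>. \<pi> \<in> A \<union> B \<Longrightarrow> \<forall>x\<in>set \<pi>. 0 < x" "A \<inter> B = {}"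
  shows "gen_fun (A \<union> B) = gen_fun A + gen_fun B"
proof (rule fps_ext)
  fix n
  have "{\<pi> \<in> A \<union> B. sum_list \<pi> = n} = {\<pi> \<in> A. sum_list \<pi> = n} \<union> {\<pi> \<in> B. sum_list \<pi> = n}"
    by auto
  moreover have "finite {\<pi> \<in> A. sum_list \<pi> = n}" "finite {\<pi> \<in> B. sum_list \<pi> = n}"
    using assms(1) by (auto intro: finite_sum_list_eq)
  moreover have "{\<pi> \<in> A. sum_list \<pi> = n} \<inter> {\<pi> \<in> B. sum_list \<pi> = n} = {}"
    using assms(2) by auto
  ultimately show "fps_nth (gen_fun (A \<union> B)) n = fps_nth (gen_fun A + gen_fun B) n"
    by (simp only: gen_fun_def fps_nth_Abs_fps fps_add_nth card_Un_disjoint of_nat_add)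
qed

lemma gen_fun_append: "gen_fun ((\<lambda>\<pi>. \<pi> @ \<nu>) ` A) = fps_X ^ sum_list \<nu> * gen_fun A"
proof (rule fps_ext)
  fix n
  have "{\<pi> \<in> (\<lambda>\<pi>. \<pi> @ \<nu>) ` A. sum_list \<pi> = n} =
      (\<lambda>\<pi>. \<pi> @ \<nu>) ` {\<pi> \<in> A. sum_list \<pi> + sum_list \<nu> = n}"
    by auto
  then have "card {\<pi> \<in> (\<lambda>\<pi>. \<pi> @ \<nu>) ` A. sum_list \<pi> = n} = card {\<pi> \<in> A. sum_list \<pi> + sum_list \<nu> = n}"
    by (simp add: card_image inj_on_def)
  also have "\<dots> = (if n < sum_list \<nu> then 0 else card {\<pi> \<in> A. sum_list \<pi> = n - sum_list \<nu>})"
    by (auto intro!: arg_cong[of _ _ card])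
  finally show "fps_nth (gen_fun ((\<lambda>\<pi>. \<pi> @ \<nu>) ` A)) n = fps_nth (fps_X ^ sum_list \<nu> * gen_fun A) n"
    by (simp add: gen_fun_def fps_X_power_mult_nth)
qed

definition adm_exact :: "nat \<Rightarrow> nat \<Rightarrow> nat \<Rightarrow> nat \<Rightarrow> nat list set" where
  "adm_exact K j m p = {\<pi>. admissible K p \<pi> \<and> (\<forall>x\<in>set \<pi>. j + 1 \<le> x) \<and> count_list \<pi> (j + 1) = m}"

lemma gen_fun_adm_lists_Suc:
  "gen_fun (adm_lists K j (Suc m) p) = gen_fun (adm_lists K j m p) + gen_fun (adm_exact K j (Suc m) p)"
proof -
  have "adm_lists K j (Suc m) p = adm_lists K j m p \<union> adm_exact K j (Suc m) p"
    by (auto simp: adm_lists_def adm_exact_def le_Suc_eq)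
  moreover have "gen_fun (adm_lists K j m p \<union> adm_exact K j (Suc m) p) =
      gen_fun (adm_lists K j m p) + gen_fun (adm_exact K j (Suc m) p)"
  proof (rule gen_fun_Un)
    show "\<forall>x\<in>set \<pi>. 0 < x" if "\<pi> \<in> adm_lists K j m p \<union> adm_exact K j (Suc m) p" for \<pi>
    proof
      fix x assume "x \<in> set \<pi>"
      with that have "j + 1 \<le> x" unfolding adm_lists_def adm_exact_def by blast
      then show "0 < x" by simp
    qed
    show "adm_lists K j m p \<inter> adm_exact K j (Suc m) p = {}"
      unfolding adm_lists_def adm_exact_def by auto
  qed
  ultimately show ?thesis by simp
qed

lemma adm_lists_0: "adm_lists K j 0 p = adm_exact K j 0 p"
  by (auto simp: adm_lists_def adm_exact_def)

lemma adm_exact_eq_image: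
  assumes "0 < K"
  shows "adm_exact K j m p = (\<lambda>\<nu>. \<nu> @ replicate m (j + 1)) `
    {\<nu>. admissible K p \<nu> \<and> (\<forall>x\<in>set \<nu>. j + 2 \<le> x) \<and> count_list \<nu> (j + 2) + m \<le> K \<and>
      (count_list \<nu> (j + 2) + m = K \<longrightarrow> [count_list \<nu> (j + 2) * (j + 2) + m * (j + 1) = p] (mod 2))}"
    (is "_ = _ ` ?S")
proof (intro equalityI subsetI)
  fix \<pi> assume \<pi>: "\<pi> \<in> adm_exact K j m p"
  then obtain \<nu> where \<nu>: "\<pi> = \<nu> @ replicate m (j + 1)" "sorted_wrt (\<ge>) \<nu>" "\<forall>x\<in>set \<nu>. j + 1 + 1 \<le> x"
    using sorted_desc_split[of \<pi> "j + 1"] by (auto simp: adm_exact_def admissible_def)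
  have "\<nu> \<in> ?S"
    using \<pi> admissible_append_replicate[OF assms \<nu>(2,3), of p m] \<nu>(3)
    unfolding adm_exact_def \<nu>(1) by simp
  then show "\<pi> \<in> (\<lambda>\<nu>. \<nu> @ replicate m (j + 1)) ` ?S"
    using \<nu>(1) by blast
next
  fix \<pi> assume "\<pi> \<in> (\<lambda>\<nu>. \<nu> @ replicate m (j + 1)) ` ?S"
  then obtain \<nu> where \<nu>: "\<pi> = \<nu> @ replicate m (j + 1)" "\<nu> \<in> ?S" by blast
  then have s: "sorted_wrt (\<ge>) \<nu>" "\<forall>x\<in>set \<nu>. j + 1 + 1 \<le> x"
    by (auto simp: admissible_def)
  have "count_list \<nu> (j + 1) = 0"
    using s(2) by (auto simp: count_list_0_iff)
  then show "\<pi> \<in> adm_exact K j m p"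
    using admissible_append_replicate[OF assms s, of p m] \<nu>
    by (auto simp: adm_exact_def count_list_replicate)
qed

text \<open>The window of \<open>K - m\<close> parts \<open>j + 2\<close> and \<open>m\<close> parts
  \<open>j + 1\<close> has the required parity, so the remaining list may contain up to
  \<open>K - m\<close> parts \<open>j + 2\<close>.\<close>

lemma gen_fun_adm_exact_even:
  assumes "0 < K" "m \<le> K" "[(K - m) * (j + 2) + m * (j + 1) = p] (mod 2)"
  shows "gen_fun (adm_exact K j m p) = fps_X ^ (Suc j * m) * gen_fun (adm_lists K (Suc j) (K - m) p)"
proof -
  have "c + m \<le> K \<and> (c + m = K \<longrightarrow> [c * (j + 2) + m * (j + 1) = p] (mod 2)) \<longleftrightarrow> c \<le> K - m" for c
  proof (cases "c + m = K")
    case True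
    then have "c = K - m" by simp
    then show ?thesis using True assms by auto
  next
    case False
    then show ?thesis using assms by auto
  qed
  then have "adm_exact K j m p = (\<lambda>\<nu>. \<nu> @ replicate m (j + 1)) ` adm_lists K (Suc j) (K - m) p"
    unfolding adm_exact_eq_image[OF \<open>0 < K\<close>] adm_lists_def by simp
  then show ?thesis
    by (simp add: gen_fun_append sum_list_replicate mult.commute)
qed

text \<open>Here that window has the wrong parity, which excludes exactly \<open>K - m\<close> parts
  \<open>j + 2\<close> and lowers the bound by one. For \<open>m = K\<close> nothing would remain,
  whereas \<open>K - Suc m\<close> would truncate to 0; hence \<open>m < K\<close>.\<close>

lemma gen_fun_adm_exact_odd:
  assumes "m < K" "\<not> [(K - m) * (j + 2) + m * (j + 1) = p] (mod 2)"
  shows "gen_fun (adm_exact K j m p) = fps_X ^ (Suc j * m) * gen_fun (adm_lists K (Suc j) (K - Suc m) p)"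
proof -
  have "c + m \<le> K \<and> (c + m = K \<longrightarrow> [c * (j + 2) + m * (j + 1) = p] (mod 2)) \<longleftrightarrow> c \<le> K - Suc m" for c
  proof (cases "c + m = K")
    case True
    then have "c = K - m" by simp
    then show ?thesis using True assms by auto
  next
    case False
    then show ?thesis using assms by auto
  qed
  then have "adm_exact K j m p = (\<lambda>\<nu>. \<nu> @ replicate m (j + 1)) ` adm_lists K (Suc j) (K - Suc m) p"
    unfolding adm_exact_eq_image[OF order_le_less_trans[OF le0 \<open>m < K\<close>]] adm_lists_def by simp
  then show ?thesis
    by (simp add: gen_fun_append sum_list_replicate mult.commute)
qed

lemma adm_lists_cong: "[p = p'] (mod 2) \<Longrightarrow> adm_lists K j m p = adm_lists K j m p'"
  unfolding adm_lists_def admissible_def by (simp add: cong_def)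

subsection \<open>Shelves and ghosts as generating functions\<close>

text \<open>With \<open>r = K * j + u + 1\<close> and \<open>k = K + 1\<close> the residue is that
  of \<open>r + k\<close>, opposite to the parity for the ghost of index \<open>r\<close>. The value
  0 beyond \<open>K\<close> is the convention that makes the last position of a row fit the general
  recursion.\<close>

definition comb_shelf :: "nat \<Rightarrow> nat \<Rightarrow> nat \<Rightarrow> complex fps" where
  "comb_shelf K j u = (if u \<le> K then gen_fun (adm_lists K j (K - u) (K * j + u + K)) else 0)"

text \<open>\<open>comb_ghost K j w\<close> belongs to the ghost with index \<open>(k - 1) * j + i\<close>, \<open>i = w + 2\<close>.\<close>

definition comb_ghost :: "nat \<Rightarrow> nat \<Rightarrow> nat \<Rightarrow> complex fps" where
  "comb_ghost K j w = gen_fun (adm_lists K j (K - Suc w) (K * j + w + K))"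

text \<open>At position \<open>K\<close> no part \<open>j + 1\<close> is allowed, and
  \<open>K\<close> parts \<open>j + 2\<close> have a sum of the right parity, so up to
  \<open>K\<close> of them may occur.\<close>

lemma comb_shelf_edge:
  assumes "0 < K"
  shows "comb_shelf K (Suc j) 0 = comb_shelf K j K"
proof -
  have "comb_shelf K j K = gen_fun (adm_lists K (Suc j) K (K * j + K + K))"
    using assms by (simp add: comb_shelf_def adm_lists_0 gen_fun_adm_exact_even algebra_simps)
  also have "K * j + K + K = K * Suc j + 0 + K" by simp
  finally show ?thesis by (simp add: comb_shelf_def)
qed

text \<open>The residue attached to position \<open>K - w\<close> of row \<open>j + 1\<close> agrees
  modulo 2 with that of position \<open>w\<close> of row \<open>j\<close>, so the lists left after
  removing the parts \<open>j + 1\<close> are counted by a shelf of the next row.\<close>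

lemma comb_shelf_Suc_flip:
  assumes "w < K"
  shows "comb_shelf K (Suc j) (K - w) = gen_fun (adm_lists K (Suc j) w (K * j + w + K))"
proof -
  have "K * Suc j + (K - w) + K = K * j + w + K + 2 * (K - w)"
    using assms by simp
  then have "[K * Suc j + (K - w) + K = K * j + w + K] (mod 2)"
    unfolding cong_def by (simp only: mod_mult_self2)
  then show ?thesis
    using assms by (simp add: comb_shelf_def adm_lists_cong)
qed

text \<open>The lists with the maximal number \<open>K - w\<close> of parts \<open>j + 1\<close> are
  split off. The critical window sum is then exactly the residue \<open>K * j + w + K\<close>, so
  \<open>gen_fun_adm_exact_even\<close> applies.\<close>

lemma comb_shelf_eq_ghost:
  assumes "w < K"
  shows "comb_shelf K j w = comb_ghost K j w + fps_X ^ (Suc j * (K - w)) * comb_shelf K (Suc j) (K - w)"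
proof -
  obtain d where K: "K = Suc (w + d)"
    using assms less_imp_Suc_add by blast
  have "K - w = Suc d" "K - Suc w = d" "K - Suc d = w" "0 < K" "Suc d \<le> K" by (simp_all add: K)
  moreover have "w * (j + 2) + Suc d * (j + 1) = K * j + w + K"
    by (simp add: K algebra_simps)
  then have "[(K - Suc d) * (j + 2) + Suc d * (j + 1) = K * j + w + K] (mod 2)"
    unfolding \<open>K - Suc d = w\<close> by (simp only: cong_refl)
  ultimately show ?thesis
    using gen_fun_adm_exact_even[of K "Suc d" j] assms
    unfolding comb_shelf_Suc_flip[OF assms] comb_ghost_def
    by (simp add: comb_shelf_def gen_fun_adm_lists_Suc)
qed

text \<open>The same splitting, now at the maximal number \<open>K - Suc w\<close> of parts
  \<open>j + 1\<close>. One more part \<open>j + 2\<close> in the critical window raises its sum by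
  one, so \<open>gen_fun_adm_exact_odd\<close> applies and leads to the same shelf of row
  \<open>j + 1\<close>.\<close>

lemma comb_ghost_eq_shelf:
  assumes "w < K"
  shows "comb_ghost K j w =
    comb_shelf K j (w + 2) + fps_X ^ (Suc j * (K - Suc w)) * comb_shelf K (Suc j) (K - w)"
proof -
  obtain d where K: "K = Suc (w + d)"
    using assms less_imp_Suc_add by blast
  have *: "K - Suc w = d" "K - d = Suc w" "K - Suc d = w" "d < K" by (simp_all add: K)
  have eq: "Suc w * (j + 2) + d * (j + 1) = Suc (K * j + w + K)"
    by (simp add: K algebra_simps)
  have "\<not> [(K - d) * (j + 2) + d * (j + 1) = K * j + w + K] (mod 2)"
    unfolding \<open>K - d = Suc w\<close> eq cong_def by presburger
  then have exact: "gen_fun (adm_exact K j d (K * j + w + K)) =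
      fps_X ^ (Suc j * d) * comb_shelf K (Suc j) (K - w)"
    unfolding comb_shelf_Suc_flip[OF assms] using gen_fun_adm_exact_odd[OF \<open>d < K\<close>] * by simp
  show ?thesis
  proof (cases d)
    \<comment> \<open>Here \<open>w + 2 = K + 1\<close>: the shelf on the right is 0, and no list in
      the ghost contains \<open>j + 1\<close>.\<close>
    case 0
    then show ?thesis
      using exact * by (simp add: comb_ghost_def comb_shelf_def adm_lists_0 K)
  next
    case (Suc d')
    have "[K * j + (w + 2) + K = K * j + w + K] (mod 2)"
      by (simp add: cong_def)
    then have "comb_shelf K j (w + 2) = gen_fun (adm_lists K j d' (K * j + w + K))"
      unfolding comb_shelf_def by (subst adm_lists_cong) (simp_all add: K Suc)
    then show ?thesis
      using exact unfolding comb_ghost_def *(1) by (simp add: Suc gen_fun_adm_lists_Suc)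
  qed
qed

text \<open>A nonempty list with all parts at least \<open>j + 1\<close> has sum greater than
  \<open>j\<close>, so only the empty list is seen to order \<open>j\<close>.\<close>

lemma comb_shelf_cong_1:
  assumes "0 < K" "u \<le> K"
  shows "fps_X ^ j dvd comb_shelf K j u - 1"
  unfolding fps_X_power_dvd_iff
proof (intro allI impI)
  fix n assume "n < j"
  let ?A = "adm_lists K j (K - u) (K * j + u + K)"
  have *: "\<pi> = []" if "\<pi> \<in> ?A" "sum_list \<pi> = n" for \<pi>
  proof (cases \<pi>)
    case (Cons x \<nu>)
    then have "j + 1 \<le> x" "x \<le> n" using that by (auto simp: adm_lists_def)
    then show ?thesis using \<open>n < j\<close> by simp
  qed
  have "[] \<in> ?A"
    using \<open>0 < K\<close> by (simp add: adm_lists_def admissible_def)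
  then have "\<pi> \<in> ?A \<and> sum_list \<pi> = n \<longleftrightarrow> \<pi> = [] \<and> n = 0" for \<pi>
    using *[of \<pi>] by auto
  then have "{\<pi> \<in> ?A. sum_list \<pi> = n} = (if n = 0 then {[]} else {})"
    by auto
  then show "fps_nth (comb_shelf K j u - 1) n = 0"
    using \<open>u \<le> K\<close> by (simp add: comb_shelf_def gen_fun_def)
qed

lemma comb_shelf_eq_shelf:
  assumes "0 < K" "u \<le> K"
  shows "comb_shelf K j u = shelf K j u"
proof (rule shelf_unique[OF _ _ _ _ assms])
  show "comb_shelf K j w = comb_shelf K j (w + 2) +
      fps_X ^ (Suc j * (K - Suc w)) * (1 + fps_X ^ Suc j) * comb_shelf K (Suc j) (K - w)"
    if "w < K" for j w
  proof -
    \<comment> \<open>Eliminating the ghost leaves two multiples of the same shelf, with exponents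
      differing by \<open>Suc j\<close>; their sum produces the factor
      \<open>1 + fps_X ^ Suc j\<close>.\<close>
    have "K - w = Suc (K - Suc w)" using that by simp
    then have "Suc j * (K - w) = Suc j * (K - Suc w) + Suc j"
      by (simp only: mult_Suc_right add.commute)
    then have "fps_X ^ (Suc j * (K - w)) = fps_X ^ (Suc j * (K - Suc w)) * (fps_X :: complex fps) ^ Suc j"
      by (simp only: power_add)
    then show ?thesis
      unfolding comb_shelf_eq_ghost[OF that] comb_ghost_eq_shelf[OF that]
      by (simp only: distrib_left distrib_right mult_1_right add.assoc)
  qed
  show "comb_shelf K (Suc j) 0 = comb_shelf K j K" for j
    by (rule comb_shelf_edge[OF \<open>0 < K\<close>])
  show "comb_shelf K j (K + 1) = 0" for j
    by (simp add: comb_shelf_def)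
  show "fps_X ^ j dvd comb_shelf K j v - 1" if "v \<le> K" for j v
    by (rule comb_shelf_cong_1[OF \<open>0 < K\<close> that])
qed

section \<open>The defining recursion and the closed form\<close>

lemma ghost_of_shelf:
  assumes "w < K" and b: "\<And>u. u \<le> K \<Longrightarrow> b (u + 1) = fps_to_fls (shelf K j u)"
  shows "ghost_of (K + 1) j b (w + 2) =
    fps_to_fls (shelf K j (w + 2) + fps_X ^ (Suc j * (K - Suc w)) * shelf K (Suc j) (K - w))"
proof -
  define q :: "complex fls" where "q = fls_X ^ (j + 1)"
  have q: "fps_to_fls (fps_X ^ Suc j) = q"
    by (simp add: q_def fps_to_fls_power del: power_Suc)
  define s where "s = fps_to_fls (shelf K j (w + 2))"
  define t where "t = fps_to_fls (fps_X ^ (Suc j * (K - Suc w)) * shelf K (Suc j) (K - w))"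
  have "1 + q \<noteq> 0"
  proof -
    have "fps_nth (1 + fps_X ^ Suc j :: complex fps) 0 \<noteq> 0" by simp
    then have "(1 + fps_X ^ Suc j :: complex fps) \<noteq> 0" by force
    then have "fps_to_fls (1 + fps_X ^ Suc j :: complex fps) \<noteq> 0"
      by (rule fps_to_fls_nonzeroI)
    then show ?thesis unfolding fps_to_fls_plus q by simp
  qed
  have "shelf K j w = shelf K j (w + 2) +
      (1 + fps_X ^ Suc j) * (fps_X ^ (Suc j * (K - Suc w)) * shelf K (Suc j) (K - w))"
    unfolding shelf_step[OF \<open>w < K\<close>] by (simp only: mult_ac)
  then have "fps_to_fls (shelf K j w) = s + (1 + q) * t"
    by (simp only: fps_to_fls_plus fls_times_fps_to_fls s_def t_def q fps_one_to_fls)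
  then have 1: "b (w + 1) = s + (1 + q) * t"
    using b[of w] \<open>w < K\<close> by simp
  have "ghost_of (K + 1) j b (w + 2) = (b (w + 1) + q * s) / (1 + q)"
  proof (cases "w + 2 = K + 1")
    case True
    then have "s = 0" using shelf_top[of K j] by (simp add: s_def)
    moreover have "K = w + 1" using True by simp
    ultimately show ?thesis by (simp add: ghost_of_def q_def)
  next
    case False
    then have "b (w + 3) = s"
      using b[of "w + 2"] \<open>w < K\<close> by (simp add: s_def numeral_3_eq_3)
    then show ?thesis
      using False by (simp add: ghost_of_def q_def numeral_3_eq_3)
  qed
  \<comment> \<open>The weighted mean of \<open>s + (1 + q) * t\<close> and \<open>s\<close> with
    weights 1 and \<open>q\<close> is \<open>s + t\<close>.\<close>
  also have "\<dots> = s + t"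
    using \<open>1 + q \<noteq> 0\<close> unfolding 1 by (simp add: field_simps)
  finally show ?thesis by (simp add: s_def t_def)
qed

lemma B_block_eq_shelf:
  assumes "u \<le> K"
  shows "B_block (K + 1) j (u + 1) = fps_to_fls (shelf K j u)"
  using assms
proof (induction j arbitrary: u)
  case 0
  then show ?case using B_init_eq_shelf by simp
next
  case (Suc j)
  show ?case
  proof (cases "u = 0")
    case True
    then show ?thesis using Suc.IH[of K] by (simp add: shelf_edge)
  next
    case False
    define w where "w = K - u"
    have w: "w < K" "u = K - w" and "u = Suc (K - Suc w)"
      using False Suc.prems by (auto simp: w_def)
    from \<open>u = Suc (K - Suc w)\<close> have e: "Suc j * u = Suc j * (K - Suc w) + Suc j"
      by (simp only: mult_Suc_right add.commute)
    define x :: "complex fps" where "x = fps_X ^ (Suc j * (K - Suc w))"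
    have x: "fps_X ^ (Suc j * u) = x * fps_X ^ Suc j"
      unfolding e power_add x_def ..
    have ghost: "ghost_of (K + 1) j (B_block (K + 1) j) (w + 2) =
        fps_to_fls (shelf K j (w + 2) + x * shelf K (Suc j) u)"
      using ghost_of_shelf[OF \<open>w < K\<close> Suc.IH] unfolding x_def w(2) by simp
    have "B_block (K + 1) (Suc j) (u + 1) =
        (B_block (K + 1) j (w + 1) - ghost_of (K + 1) j (B_block (K + 1) j) (w + 2)) / fls_X ^ (Suc j * u)"
    \<comment> \<open>The recursion treats \<open>i = 2\<close> separately; with
      \<open>w + 1 = K\<close> its formula is the general one.\<close>
    proof (cases "u = 1")
      case True
      then have "w + 1 = K" using w by simp
      then show ?thesis using True by simp
    next
      case False
      have "K + 1 - (u + 1) + 1 = w + 1" "K + 1 - (u + 1) + 2 = w + 2"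
        by (simp_all add: w_def)
      then show ?thesis using False \<open>u \<noteq> 0\<close> by simp
    qed
    also have "B_block (K + 1) j (w + 1) - ghost_of (K + 1) j (B_block (K + 1) j) (w + 2) =
        fps_to_fls (shelf K j w - (shelf K j (w + 2) + x * shelf K (Suc j) u))"
      using w(1) by (simp only: ghost Suc.IH less_imp_le fps_to_fls_minus)
    also have "shelf K j w - (shelf K j (w + 2) + x * shelf K (Suc j) u) = fps_X ^ (Suc j * u) * shelf K (Suc j) u"
      unfolding shelf_step[OF w(1)] x unfolding x_def[symmetric] w(2)[symmetric]
      by (simp add: algebra_simps)
    also have "fps_to_fls \<dots> / fls_X ^ (Suc j * u) = fps_to_fls (shelf K (Suc j) u)"
      unfolding fls_times_fps_to_fls fps_to_fls_power fps_X_to_fls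
      by (rule nonzero_mult_div_cancel_left) simp
    finally show ?thesis .
  qed
qed

text \<open>For a nonincreasing list a bound on the last part bounds all parts, and the bound
  \<open>J + 1\<close> includes positivity.\<close>

lemma ghost_count_eq:
  "ghost_count (K + 1) J i n = card {\<pi> \<in> adm_lists K J (K + 1 - i) (K * J + i + K + 2). sum_list \<pi> = n}"
proof -
  have last: "(\<pi> \<noteq> [] \<longrightarrow> J + 1 \<le> last \<pi>) \<longleftrightarrow> (\<forall>x\<in>set \<pi>. J + 1 \<le> x)"
    if "sorted_wrt (\<ge>) \<pi>" for \<pi> :: "nat list"
    using that by (cases \<pi> rule: rev_cases) (auto simp: sorted_wrt_append)
  have "is_partition n \<pi> \<and> (\<pi> \<noteq> [] \<longrightarrow> J + 1 \<le> last \<pi>) \<longleftrightarrow>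
    sorted_wrt (\<ge>) \<pi> \<and> (\<forall>x\<in>set \<pi>. J + 1 \<le> x) \<and> sum_list \<pi> = n" for \<pi>
    using last[of \<pi>] unfolding is_partition_def by fastforce
  then show ?thesis
    unfolding ghost_count_def adm_lists_def admissible_def
    by (intro arg_cong[of _ _ card] Collect_cong) (auto simp: add.assoc)
qed

theorem theorem7p4:
  fixes k J i r :: nat
  assumes "k \<ge> 2" and "i \<in> {2..k}" and "r = (k - 1) * J + i"
  shows "ghost_series k r = fps_to_fls (Abs_fps (\<lambda>n. of_nat (ghost_count k J i n)))"
proof -
  define K w where "K = k - 1" and "w = i - 2"
  have k: "k = K + 1" and i: "i = w + 2" and "w < K" "0 < K"
    using assms by (auto simp: K_def w_def)
  have "ghost_series k r = ghost_of k J (B_block k J) i"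
    unfolding assms(3) by (rule ghost_series_eq) (use assms in auto)
  also have "\<dots> = fps_to_fls (shelf K J (w + 2) + fps_X ^ (Suc J * (K - Suc w)) * shelf K (Suc J) (K - w))"
    unfolding k i by (rule ghost_of_shelf[OF \<open>w < K\<close> B_block_eq_shelf])
  also have "shelf K J (w + 2) = comb_shelf K J (w + 2)"
  proof (cases "w + 2 \<le> K")
    case False
    then have "w + 2 = K + 1" using \<open>w < K\<close> by simp
    then show ?thesis using shelf_top[of K J] by (simp add: comb_shelf_def)
  qed (simp add: comb_shelf_eq_shelf \<open>0 < K\<close>)
  also have "shelf K (Suc J) (K - w) = comb_shelf K (Suc J) (K - w)"
    by (simp add: comb_shelf_eq_shelf \<open>0 < K\<close>)
  also have "comb_shelf K J (w + 2) + fps_X ^ (Suc J * (K - Suc w)) * comb_shelf K (Suc J) (K - w) =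
      comb_ghost K J w"
    by (rule comb_ghost_eq_shelf[OF \<open>w < K\<close>, symmetric])
  also have "comb_ghost K J w = Abs_fps (\<lambda>n. of_nat (ghost_count k J i n))"
  proof -
    have "[K * J + w + K = K * J + i + K + 2] (mod 2)"
      by (simp add: i cong_def)
    then have "adm_lists K J (K - Suc w) (K * J + w + K) = adm_lists K J (K + 1 - i) (K * J + i + K + 2)"
      using adm_lists_cong by (simp add: i)
    then show ?thesis
      by (simp add: comb_ghost_def gen_fun_def k ghost_count_eq[simplified])
  qed
  finally show ?thesis .
qed

end
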